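(* Let $n\ge 2$, $k\in\{1,\ldots,n-1\}$ and $f\in C(k,n)$. Then $$I^{-k}(I^{k}f)=f$$ at every point of $\mathbb{R}^n$.
   Context: Functions are complex-valued. For $a>0$, $C_a(\mathbb{R}^n)$ is the set of continuous functions $f$ on $\mathbb{R}^n$ with $f(x)=O(|x|^{-a})$ as $|x|\to\infty$. $C(k,n)$ is the set of functions $f$ on $\mathbb{R}^n$ such that $f\in C_{k+\delta}(\mathbb{R}^n)$ for some $\delta>0$ and such that for each $x\in\mathbb{R}^n$ there exist a neighborhood $\mathcal{O}$ of $x$, an $\epsilon$ with $0<\epsilon<1$ and an $M>0$ with $|f(x_1)-f(x_2)|\le M|x_1-x_2|^{\epsilon}$ for all $x_1,x_2\in\mathcal{O}$. Riesz potentials: $H_n(\alpha)=2^{\alpha}\pi^{n/2}\Gamma(\alpha/2)/\Gamma((n-\alpha)/2)$. For $g\in C_b(\mathbb{R}^n)$ with $b>0$, $x\in\mathbb{R}^n$ and $\alpha\in\mathbb{C}\setminus\{n,n+2,n+4,\ldots\}$ with $0<\operatorname{Re}\alpha<b$, $$(I^{\alpha}g)(x)=\frac{1}{H_n(\alpha)}\int_{\mathbb{R}^n}g(y)|x-y|^{\alpha-n}\,dy .$$ For $\operatorname{Re}\alpha\le 0$, $(I^{\alpha}g)(x)$ denotes the value at $\alpha$ of the analytic continuation of the map $\alpha\mapsto(I^{\alpha}g)(x)$ from $\{0<\operatorname{Re}\alpha<b\}$ to a larger strip $\{c<\operatorname{Re}\alpha<b\}$, $c<0$. If, in a neighborhood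 of $x$, $g$ is $C^l$ with all order-$l$ derivatives Hölder continuous of index $\epsilon\in(0,1)$, then this (meromorphic) continuation exists on $\{-l-\epsilon<\operatorname{Re}\alpha<b\}$, with poles only in $\{n,n+2,\ldots\}$. Here $I^{-k}$ is taken in this sense. *)

theory Defs
  imports "HOL-Complex_Analysis.Complex_Analysis" "HOL-Library.Landau_Symbols"
begin

text \<open>The dimension \<open>n\<close> is the cardinality of the index type \<open>'n\<close> of \<open>real ^ 'n\<close>;
  \<open>decay_space a\<close> is \<open>C\<^sub>a(\<real>\<^sup>n)\<close> and \<open>C_space k\<close> is \<open>C(k,n)\<close>.\<close>

definition decay_space :: "real \<Rightarrow> (real ^ 'n \<Rightarrow> complex) set" where
  "decay_space a = {f. continuous_on UNIV f \<and>
     (\<lambda>x. norm (f x)) \<in> O[at_infinity](\<lambda>x. norm x powr (- a))}"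

definition locally_Hoelder :: "(real ^ 'n \<Rightarrow> complex) \<Rightarrow> bool" where
  "locally_Hoelder f \<longleftrightarrow> (\<forall>x. \<exists>U \<epsilon> M. open U \<and> x \<in> U \<and> 0 < \<epsilon> \<and> \<epsilon> < 1 \<and> 0 < M \<and>
     (\<forall>x1\<in>U. \<forall>x2\<in>U. norm (f x1 - f x2) \<le> M * norm (x1 - x2) powr \<epsilon>))"

definition C_space :: "nat \<Rightarrow> (real ^ 'n \<Rightarrow> complex) set" where
  "C_space k = {f. (\<exists>\<delta>>0. f \<in> decay_space (real k + \<delta>)) \<and> locally_Hoelder f}"

definition riesz_const :: "nat \<Rightarrow> complex \<Rightarrow> complex" where
  "riesz_const n \<alpha> =
     2 powr \<alpha> * of_real (pi powr (real n / 2)) * Gamma (\<alpha> / 2) / Gamma ((of_nat n - \<alpha>) / 2)"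

definition riesz_poles :: "nat \<Rightarrow> complex set" where
  "riesz_poles n = {of_nat (n + 2 * j) | j. True}"

text \<open>Meaningful for \<open>g \<in> decay_space b\<close>, \<open>0 < Re \<alpha> < b\<close> and \<open>\<alpha>\<close> outside \<open>riesz_poles\<close>; the
  integral then converges absolutely. The junk value of the kernel at \<open>y = x\<close> is irrelevant.\<close>

definition riesz_integral :: "complex \<Rightarrow> (real ^ 'n \<Rightarrow> complex) \<Rightarrow> real ^ 'n \<Rightarrow> complex" where
  "riesz_integral \<alpha> g x = 1 / riesz_const CARD('n) \<alpha> *
     (LINT y|lborel. g y * of_real (norm (x - y)) powr (\<alpha> - of_nat CARD('n)))"

text \<open>\<open>v\<close> is the value at \<open>\<alpha>\<close> of the analytic continuation of \<open>\<beta> \<mapsto> riesz_integral \<beta> g x\<close> from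
  \<open>0 < Re \<beta> < b\<close> to \<open>c < Re \<beta> < b\<close>. The strips without \<open>riesz_poles\<close> are connected, so
  \<open>v\<close> is unique and does not depend on the choice of \<open>b\<close> and \<open>c\<close>.\<close>

definition riesz_continuation_value ::
  "complex \<Rightarrow> (real ^ 'n \<Rightarrow> complex) \<Rightarrow> real ^ 'n \<Rightarrow> complex \<Rightarrow> bool" where
  "riesz_continuation_value \<alpha> g x v \<longleftrightarrow> (\<exists>b c F. 0 < b \<and> g \<in> decay_space b \<and> c < 0 \<and> c < Re \<alpha> \<and>
     F holomorphic_on ({\<beta>. c < Re \<beta> \<and> Re \<beta> < b} - riesz_poles CARD('n)) \<and>
     (\<forall>\<beta>. 0 < Re \<beta> \<and> Re \<beta> < b \<and> \<beta> \<notin> riesz_poles CARD('n) \<longrightarrow> F \<beta> = riesz_integral \<beta> g x) \<and>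
     F \<alpha> = v)"

text \<open>\<open>riesz_defined \<alpha> g x\<close>: \<open>(I\<^sup>\<alpha> g)(x)\<close> is meaningful; \<open>riesz_potential \<alpha> g x\<close> is its value.\<close>

definition riesz_defined :: "complex \<Rightarrow> (real ^ 'n \<Rightarrow> complex) \<Rightarrow> real ^ 'n \<Rightarrow> bool" where
  "riesz_defined \<alpha> g x \<longleftrightarrow>
     (if 0 < Re \<alpha> then \<alpha> \<notin> riesz_poles CARD('n) \<and> (\<exists>b. Re \<alpha> < b \<and> g \<in> decay_space b)
      else (\<exists>v. riesz_continuation_value \<alpha> g x v))"

definition riesz_potential :: "complex \<Rightarrow> (real ^ 'n \<Rightarrow> complex) \<Rightarrow> real ^ 'n \<Rightarrow> complex" where
  "riesz_potential \<alpha> g x =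
     (if 0 < Re \<alpha> then riesz_integral \<alpha> g x else (THE v. riesz_continuation_value \<alpha> g x v))"

end

theory Submission
  imports Defs "HOL-Probability.Distributions"
begin

text \<open>
  Let \<open>p\<^sub>t\<close> be the heat kernel and \<open>u(t) = (p\<^sub>t * f)(x)\<close>. Subordination writes the normalised Riesz
  kernel of order \<open>\<alpha>\<close> as \<open>\<Gamma>(\<alpha>/2)\<^sup>-\<^sup>1 \<integral> t\<^bsup>\<alpha>/2-1\<^esup> p\<^sub>t dt\<close> over \<open>t > 0\<close>, so the semigroup law \<open>p\<^sub>s * p\<^sub>t = p\<^bsub>s+t\<^esub>\<close> and
  the Beta integral give \<open>I\<^sup>\<beta> I\<^sup>k f = I\<^bsup>\<beta>+k\<^esup> f\<close> for small real \<open>\<beta> > 0\<close>; applied to the kernels themselves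
  the same computation shows the decay of \<open>I\<^sup>k f\<close>. Subordination also gives
  \<open>I\<^sup>\<gamma> f(x) = \<Gamma>(\<gamma>/2)\<^sup>-\<^sup>1 \<integral> t\<^bsup>\<gamma>/2-1\<^esup> u(t) dt\<close>. Hoelder continuity at \<open>x\<close> means \<open>u(t) - f(x) = O(t\<^bsup>\<epsilon>/2\<^esup>)\<close> as
  \<open>t \<rightarrow> 0\<close>, so splitting off \<open>f(x)\<close> on \<open>t < 1\<close> continues this in \<open>\<gamma>\<close> to \<open>Re \<gamma> > -\<epsilon>\<close> with value \<open>f(x)\<close> at
  \<open>\<gamma> = 0\<close>. By the identity theorem \<open>\<beta> \<mapsto> I\<^bsup>\<beta>+k\<^esup> f(x)\<close> is therefore the continuation of \<open>\<beta> \<mapsto> I\<^sup>\<beta>(I\<^sup>k f)(x)\<close>,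
  and \<open>\<beta> = -k\<close> corresponds to \<open>\<gamma> = 0\<close>.
\<close>

subsection \<open>The heat kernel\<close>

text \<open>The Gauss kernel of \<open>u_t = Laplace u\<close>, without the probabilistic factor
  \<open>1 / 2\<close>: each coordinate has variance \<open>2 * t\<close>. In this scaling,
  subordination of order \<open>\<alpha> / 2\<close> reproduces the constant of
  \<open>riesz_const\<close>.\<close>

definition heat :: "real \<Rightarrow> 'a::euclidean_space \<Rightarrow> real" where
  "heat t z = (4 * pi * t) powr (- real DIM('a) / 2) * exp (- (norm z)\<^sup>2 / (4 * t))"

lemma heat_nonneg [simp]: "0 \<le> heat t z"
  by (simp add: heat_def)

lemma borel_measurable_heat [measurable]:
  assumes [measurable]: "f \<in> borel_measurable M" "g \<in> borel_measurable M"
  shows "(\<lambda>x. heat (f x) (g x)) \<in> borel_measurable M"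
  unfolding heat_def by measurable

text \<open>The Gaussian splits into coordinates, which reduces integrals over the whole space to
  one-dimensional integrals of \<open>normal_density\<close>.\<close>

lemma heat_eq_prod_normal_density:
  fixes z :: "'a::euclidean_space"
  assumes "0 < t"
  shows "heat t z = (\<Prod>b\<in>Basis. normal_density 0 (sqrt (2 * t)) (z \<bullet> b))"
proof -
  have "(\<Prod>b\<in>(Basis :: 'a set). 1 / sqrt (2 * pi * (sqrt (2 * t))\<^sup>2)) = (4 * pi * t) powr (- real DIM('a) / 2)"
  proof -
    have "1 / sqrt (2 * pi * (sqrt (2 * t))\<^sup>2) = (4 * pi * t) powr (- 1 / 2)"
      using assms by (simp add: powr_minus_divide powr_half_sqrt algebra_simps)
    then show ?thesis
      using assms by (simp add: powr_power mult.commute)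
  qed
  moreover have "(\<Prod>b\<in>(Basis :: 'a set). exp (- (z \<bullet> b - 0)\<^sup>2 / (2 * (sqrt (2 * t))\<^sup>2))) = exp (- (norm z)\<^sup>2 / (4 * t))"
    using assms
    by (simp add: exp_sum[symmetric] sum_negf sum_divide_distrib[symmetric] norm_eq_sqrt_inner
        euclidean_inner[of z z] power2_eq_square[symmetric] sum_nonneg)
  ultimately show ?thesis
    by (simp only: heat_def normal_density_def prod.distrib)
qed

lemma distr_lborel_reflect:
  fixes x :: "'a::euclidean_space"
  shows "distr lborel borel (\<lambda>y. x - y) = lborel"
  using lborel_affine[of "-1" x] by (simp add: density_1)

lemma nn_integral_lborel_reflect_translate:
  fixes f :: "'a::euclidean_space \<Rightarrow> ennreal"
  assumes [measurable]: "f \<in> borel_measurable borel"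
  shows "(\<integral>\<^sup>+ y. f (x - y) \<partial>lborel) = (\<integral>\<^sup>+ y. f y \<partial>lborel)"
  by (subst (2) distr_lborel_reflect[of x, symmetric]) (simp add: nn_integral_distr)

lemma nn_integral_heat:
  fixes x :: "'a::euclidean_space"
  assumes "0 < t"
  shows "(\<integral>\<^sup>+ y. heat t (x - y) \<partial>lborel) = 1"
proof -
  have "(\<integral>\<^sup>+ y. heat t (x - y) \<partial>lborel) = (\<integral>\<^sup>+ y. heat t (y::'a) \<partial>lborel)"
    by (rule nn_integral_lborel_reflect_translate) measurable
  also have "\<dots> = (\<integral>\<^sup>+ y. (\<Prod>b\<in>Basis. ennreal (normal_density 0 (sqrt (2 * t)) ((y::'a) \<bullet> b))) \<partial>lborel)"
    using assms by (simp add: heat_eq_prod_normal_density prod_ennreal)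
  also have "\<dots> = (\<Prod>b\<in>(Basis :: 'a set). \<integral>\<^sup>+ y. ennreal (normal_density 0 (sqrt (2 * t)) y) \<partial>lborel)"
    by (rule nn_integral_lborel_prod) auto
  also have "(\<integral>\<^sup>+ y. ennreal (normal_density 0 (sqrt (2 * t)) y) \<partial>lborel) = 1"
    using assms by (subst nn_integral_eq_integral) (auto intro: integrable_normal_density)
  finally show ?thesis by simp
qed

text \<open>In each coordinate, convolving centred normal densities adds the variances
  \<open>2 * s\<close> and \<open>2 * t\<close>.\<close>

lemma nn_integral_heat_convolution:
  fixes x y :: "'a::euclidean_space"
  assumes "0 < s" "0 < t"
  shows "(\<integral>\<^sup>+ z. heat s (x - z) * heat t (z - y) \<partial>lborel) = heat (s + t) (x - y)"
proof -
  let ?N = "\<lambda>t. normal_density 0 (sqrt (2 * t))"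
  have "(\<integral>\<^sup>+ z. heat s (x - z) * heat t (z - y) \<partial>lborel) =
        (\<integral>\<^sup>+ z. heat s (x - y - (z - y)) * heat t (z - y) \<partial>lborel)"
    by (simp add: algebra_simps)
  also have "\<dots> = (\<integral>\<^sup>+ z. heat s ((x - y) - z) * heat t z \<partial>lborel)"
    by (subst (2) lborel_affine[of 1 "- y"])
       (simp_all add: nn_integral_density nn_integral_distr algebra_simps)
  also have "\<dots> = (\<integral>\<^sup>+ z. (\<Prod>b\<in>Basis. ennreal (?N s ((x - y) \<bullet> b - z \<bullet> b) * ?N t (z \<bullet> b))) \<partial>lborel)"
    using assms by (simp add: heat_eq_prod_normal_density prod_ennreal prod.distrib inner_diff_left)
  also have "\<dots> = (\<Prod>b\<in>(Basis :: 'a set). \<integral>\<^sup>+ z. ennreal (?N s ((x - y) \<bullet> b - z) * ?N t z) \<partial>lborel)"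
    by (rule nn_integral_lborel_prod) auto
  also have "\<dots> = (\<Prod>b\<in>(Basis :: 'a set). ennreal (normal_density 0 (sqrt ((sqrt (2 * s))\<^sup>2 + (sqrt (2 * t))\<^sup>2)) ((x - y) \<bullet> b)))"
    using conv_normal_density_zero_mean[of "sqrt (2 * s)" "sqrt (2 * t)"] assms
    by (intro prod.cong refl) (simp add: fun_eq_iff)
  also have "\<dots> = heat (s + t) (x - y)"
    using assms by (simp add: heat_eq_prod_normal_density prod_ennreal algebra_simps)
  finally show ?thesis .
qed

subsection \<open>Riemann--Liouville measures\<close>

text \<open>The weight of subordination as a measure, so that superpositions over time become
  iterated integrals open to Tonelli and Fubini.\<close>

definition rl_measure :: "real \<Rightarrow> real measure" where
  "rl_measure p = density lborel (\<lambda>t. ennreal (indicator {0<..} t * t powr (p - 1) / Gamma p))"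

lemma sets_rl [simp, measurable_cong]: "sets (rl_measure p) = sets borel"
  by (simp add: rl_measure_def)

lemma space_rl [simp]: "space (rl_measure p) = UNIV"
  by (simp add: rl_measure_def)

lemma sigma_finite_rl: "sigma_finite_measure (rl_measure p)"
  unfolding rl_measure_def
  by (subst sigma_finite_measure.sigma_finite_iff_density_finite[OF sigma_finite_lborel]) auto

lemma AE_rl: "AE t in rl_measure p. 0 < t"
  unfolding rl_measure_def by (subst AE_density) (auto intro!: AE_I2 split: split_indicator_asm)

lemma nn_integral_rl:
  assumes [measurable]: "\<phi> \<in> borel_measurable borel"
  shows "(\<integral>\<^sup>+ t. \<phi> t \<partial>rl_measure p) = (\<integral>\<^sup>+ t. ennreal (indicator {0<..} t * t powr (p - 1) / Gamma p) * \<phi> t \<partial>lborel)"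
  unfolding rl_measure_def by (subst nn_integral_density) auto

text \<open>The substitution \<open>s = v * t\<close> scales this to the Beta integral over the unit
  interval.\<close>

lemma nn_integral_Beta_kernel:
  assumes "0 < p" "0 < q" "0 < v"
  shows "(\<integral>\<^sup>+ s. ennreal (indicator {0<..} s * s powr (p - 1)) * ennreal (indicator {0<..} (v - s) * (v - s) powr (q - 1)) \<partial>lborel)
     = ennreal (Beta p q * v powr (p + q - 1))"
proof -
  have B: "(\<integral>\<^sup>+ t. ennreal (indicator {0..1} t * (t powr (p - 1) * (1 - t) powr (q - 1))) \<partial>lborel) = ennreal (Beta p q)"
    using nn_integral_has_integral_lebesgue[OF _ has_integral_Beta_real[OF assms(1,2)]] by simp
  have "(\<integral>\<^sup>+ s. ennreal (indicator {0<..} s * s powr (p - 1)) * ennreal (indicator {0<..} (v - s) * (v - s) powr (q - 1)) \<partial>lborel)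
    = ennreal v * (\<integral>\<^sup>+ t. ennreal (indicator {0<..} (v * t) * (v * t) powr (p - 1)) * ennreal (indicator {0<..} (v - v * t) * (v - v * t) powr (q - 1)) \<partial>lborel)"
    using assms by (subst nn_integral_real_affine[where c = v and t = 0]) auto
  also have "(\<integral>\<^sup>+ t. ennreal (indicator {0<..} (v * t) * (v * t) powr (p - 1)) * ennreal (indicator {0<..} (v - v * t) * (v - v * t) powr (q - 1)) \<partial>lborel)
    = (\<integral>\<^sup>+ t. ennreal (v powr (p + q - 2)) * ennreal (indicator {0..1} t * (t powr (p - 1) * (1 - t) powr (q - 1))) \<partial>lborel)"
  proof (rule nn_integral_cong_AE)
    \<comment> \<open>One side has an open interval, the other a closed one; they differ only at the
      endpoints, a null set.\<close>
    have "AE t in lborel. t \<noteq> (0::real)" "AE t in lborel. t \<noteq> (1::real)"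
      by (rule AE_lborel_singleton)+
    then show "AE t in lborel. ennreal (indicator {0<..} (v * t) * (v * t) powr (p - 1)) * ennreal (indicator {0<..} (v - v * t) * (v - v * t) powr (q - 1))
      = ennreal (v powr (p + q - 2)) * ennreal (indicator {0..1} t * (t powr (p - 1) * (1 - t) powr (q - 1)))"
    proof eventually_elim
      case (elim t)
      have v1: "v - v * t = v * (1 - t)" by (simp add: algebra_simps)
      show ?case
      proof (cases "0 < t \<and> t < 1")
        case True
        then have "(v * t) powr (p - 1) * (v * (1 - t)) powr (q - 1)
           = v powr (p - 1 + (q - 1)) * (t powr (p - 1) * (1 - t) powr (q - 1))"
          using assms by (simp only: powr_add powr_mult) (simp add: mult_ac)
        moreover have "p - 1 + (q - 1) = p + q - 2" by simp
        ultimately have "(v * t) powr (p - 1) * (v * (1 - t)) powr (q - 1)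
           = v powr (p + q - 2) * (t powr (p - 1) * (1 - t) powr (q - 1))" by simp
        with True assms show ?thesis
          by (simp add: v1 ennreal_mult'[symmetric] algebra_simps)
      next
        case False
        then have "\<not> (0 < v * t) \<or> \<not> (0 < v - v * t)" "t \<notin> {0..1}"
          using assms elim by (auto simp: v1 zero_less_mult_iff)
        then show ?thesis by auto
      qed
    qed
  qed
  also have "\<dots> = ennreal (v powr (p + q - 2)) * ennreal (Beta p q)"
    by (subst nn_integral_cmult) (auto simp: B)
  also have "ennreal v * \<dots> = ennreal (Beta p q * v powr (p + q - 1))"
  proof -
    have "v * v powr (p + q - 2) = v powr (p + q - 1)"
      using powr_add[of v 1 "p + q - 2"] assms by simp
    then have "v * (v powr (p + q - 2) * Beta p q) = Beta p q * v powr (p + q - 1)"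
      by (simp add: mult.assoc[symmetric] mult.commute)
    moreover have "0 \<le> Beta p q" using assms by (simp add: Beta_def)
    ultimately show ?thesis
      using assms by (simp flip: ennreal_mult'' ennreal_mult')
  qed
  finally show ?thesis .
qed

text \<open>With \<open>v = s + t\<close> and the integrals exchanged, the inner integral is
  \<open>nn_integral_Beta_kernel\<close>, and \<open>Beta p q\<close> turns
  \<open>1 / (Gamma p * Gamma q)\<close> into \<open>1 / Gamma (p + q)\<close>. This is why orders
  of Riesz potentials add.\<close>

lemma nn_integral_rl_convolution:
  assumes "0 < p" "0 < q" and [measurable]: "\<phi> \<in> borel_measurable borel"
  shows "(\<integral>\<^sup>+ s. \<integral>\<^sup>+ t. \<phi> (s + t) \<partial>rl_measure q \<partial>rl_measure p) = (\<integral>\<^sup>+ v. \<phi> v \<partial>rl_measure (p + q))"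
proof -
  let ?k = "\<lambda>p t. ennreal (indicator {0<..} t * t powr (p - 1))"
  have G: "0 < Gamma p" "0 < Gamma q" "0 < Gamma (p + q)" using assms by simp_all
  have k: "ennreal (indicator {0<..} t * t powr (r - 1) / Gamma r) = ennreal (1 / Gamma r) * ?k r t" if "0 < Gamma r" for r t
    using that by (simp add: ennreal_mult'[symmetric])
  have rl_measure: "(\<integral>\<^sup>+ t. \<psi> t \<partial>rl_measure r) = ennreal (1 / Gamma r) * (\<integral>\<^sup>+ t. ?k r t * \<psi> t \<partial>lborel)"
    if "0 < Gamma r" and [measurable]: "\<psi> \<in> borel_measurable borel" for r \<psi>
    unfolding nn_integral_rl[OF that(2)] k[OF that(1)] mult.assoc
    by (subst nn_integral_cmult) auto
  have "(\<integral>\<^sup>+ s. \<integral>\<^sup>+ t. \<phi> (s + t) \<partial>rl_measure q \<partial>rl_measure p) =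
      (\<integral>\<^sup>+ s. ennreal (1 / Gamma q) * (\<integral>\<^sup>+ t. ?k q t * \<phi> (s + t) \<partial>lborel) \<partial>rl_measure p)"
    by (intro nn_integral_cong rl_measure G) measurable
  also have "\<dots> = ennreal (1 / Gamma p) * (\<integral>\<^sup>+ s. ?k p s * (ennreal (1 / Gamma q) * (\<integral>\<^sup>+ t. ?k q t * \<phi> (s + t) \<partial>lborel)) \<partial>lborel)"
    by (intro rl_measure G) measurable
  also have "\<dots> = ennreal (1 / Gamma p) * ennreal (1 / Gamma q) * (\<integral>\<^sup>+ s. ?k p s * (\<integral>\<^sup>+ t. ?k q t * \<phi> (s + t) \<partial>lborel) \<partial>lborel)"
    by (subst nn_integral_cmult[symmetric], measurable)+ (simp add: ac_simps)
  also have "(\<integral>\<^sup>+ s. ?k p s * (\<integral>\<^sup>+ t. ?k q t * \<phi> (s + t) \<partial>lborel) \<partial>lborel)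
     = (\<integral>\<^sup>+ s. (\<integral>\<^sup>+ v. ?k p s * (?k q (v - s) * \<phi> v) \<partial>lborel) \<partial>lborel)"
  proof (rule nn_integral_cong)
    fix s :: real
    have "(\<integral>\<^sup>+ v. ?k q (v - s) * \<phi> v \<partial>lborel) = (\<integral>\<^sup>+ t. ?k q t * \<phi> (s + t) \<partial>lborel)"
      by (subst nn_integral_real_affine[where c = 1 and t = s]) auto
    then show "?k p s * (\<integral>\<^sup>+ t. ?k q t * \<phi> (s + t) \<partial>lborel) = (\<integral>\<^sup>+ v. ?k p s * (?k q (v - s) * \<phi> v) \<partial>lborel)"
      by (subst nn_integral_cmult) auto
  qed
  also have "\<dots> = (\<integral>\<^sup>+ v. (\<integral>\<^sup>+ s. ?k p s * (?k q (v - s) * \<phi> v) \<partial>lborel) \<partial>lborel)"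
    by (rule lborel_pair.Fubini') measurable
  also have "\<dots> = (\<integral>\<^sup>+ v. ennreal (Beta p q) * (?k (p + q) v * \<phi> v) \<partial>lborel)"
  proof (rule nn_integral_cong_AE)
    show "AE v in lborel. (\<integral>\<^sup>+ s. ?k p s * (?k q (v - s) * \<phi> v) \<partial>lborel) = ennreal (Beta p q) * (?k (p + q) v * \<phi> v)"
    proof (rule AE_I2)
      fix v :: real
      have "(\<integral>\<^sup>+ s. ?k p s * (?k q (v - s) * \<phi> v) \<partial>lborel) = (\<integral>\<^sup>+ s. ?k p s * ?k q (v - s) \<partial>lborel) * \<phi> v"
        by (subst nn_integral_multc[symmetric]) (auto simp: mult.assoc)
      also have "(\<integral>\<^sup>+ s. ?k p s * ?k q (v - s) \<partial>lborel) = ennreal (Beta p q) * ?k (p + q) v"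
      proof (cases "0 < v")
        case True
        have "0 \<le> Beta p q" using assms by (simp add: Beta_def)
        with True show ?thesis
          using nn_integral_Beta_kernel[OF assms(1,2) True] by (simp add: ennreal_mult')
      next
        case False
        then have "?k p s * ?k q (v - s) = 0" for s by (auto split: split_indicator)
        then have "(\<integral>\<^sup>+ s. ?k p s * ?k q (v - s) \<partial>lborel) = 0"
          by (simp only: nn_integral_const mult_zero_left)
        with False show ?thesis by simp
      qed
      finally show "(\<integral>\<^sup>+ s. ?k p s * (?k q (v - s) * \<phi> v) \<partial>lborel) = ennreal (Beta p q) * (?k (p + q) v * \<phi> v)"
        by (simp add: mult.assoc)
    qed
  qed
  also have "\<dots> = ennreal (Beta p q) * (\<integral>\<^sup>+ v. ?k (p + q) v * \<phi> v \<partial>lborel)"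
    by (rule nn_integral_cmult) measurable
  also have "ennreal (1 / Gamma p) * ennreal (1 / Gamma q) * \<dots> = ennreal (1 / Gamma (p + q)) * (\<integral>\<^sup>+ v. ?k (p + q) v * \<phi> v \<partial>lborel)"
  proof -
    have "ennreal (1 / Gamma p) * ennreal (1 / Gamma q) * ennreal (Beta p q) = ennreal (1 / Gamma (p + q))"
      using G by (simp add: ennreal_mult'[symmetric] Beta_def)
    then show ?thesis by (simp add: mult.assoc[symmetric])
  qed
  also have "\<dots> = (\<integral>\<^sup>+ v. \<phi> v \<partial>rl_measure (p + q))"
    by (rule rl_measure[symmetric]) (use G in auto)
  finally show ?thesis .
qed

subsection \<open>Riesz kernels\<close>

text \<open>The factor is \<open>1 / riesz_const\<close> at a real order. For orders strictly
  between 0 and the dimension the kernel is nonnegative, so that Tonelli applies.\<close>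

definition riesz_kernel :: "real \<Rightarrow> 'a::euclidean_space \<Rightarrow> real" where
  "riesz_kernel \<alpha> z = Gamma ((real DIM('a) - \<alpha>) / 2) / (2 powr \<alpha> * pi powr (real DIM('a) / 2) * Gamma (\<alpha> / 2))
     * norm z powr (\<alpha> - real DIM('a))"

lemma borel_measurable_riesz_kernel [measurable]:
  "f \<in> borel_measurable M \<Longrightarrow> (\<lambda>x. riesz_kernel \<alpha> (f x)) \<in> borel_measurable M"
  unfolding riesz_kernel_def by measurable

lemma riesz_kernel_nonneg [simp]:
  fixes z :: "'a::euclidean_space"
  assumes "0 < \<alpha>" "\<alpha> < real DIM('a)"
  shows "0 \<le> riesz_kernel \<alpha> z"
  using assms unfolding riesz_kernel_def by (auto intro!: mult_nonneg_nonneg divide_nonneg_nonneg)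

text \<open>The substitution \<open>t \<mapsto> c / t\<close> leads to Euler's Gamma
  integral.\<close>

lemma nn_integral_inverse_Gamma:
  assumes "0 < p" "0 < c"
  shows "(\<integral>\<^sup>+ t. ennreal (indicator {0<..} t * (t powr (- p - 1) * exp (- c / t))) \<partial>lborel) = ennreal (Gamma p * c powr (- p))"
proof -
  let ?f = "\<lambda>t :: real. t powr (p - 1) / exp t"
  have inj: "inj_on (\<lambda>t. c / t) {0<..}" using assms by (auto simp: inj_on_def field_simps)
  have im: "(\<lambda>t. c / t) ` {0<..} = {0<..}"
  proof (intro equalityI subsetI)
    fix t assume "t \<in> {0::real<..}"
    then have "t = c / (c / t)" "c / t \<in> {0<..}" using assms by auto
    then show "t \<in> (\<lambda>t. c / t) ` {0<..}" by blast
  qed (use assms in auto)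
  \<comment> \<open>The endpoint is dropped because \<open>c / t\<close> is a bijection of the open
    half-line only.\<close>
  have hi: "(?f has_integral Gamma p) {0<..}"
  proof -
    have "(?f has_integral Gamma p) {0..}" by (rule Gamma_integral_real) fact
    then show ?thesis
      by (subst (asm) has_integral_spike_set_eq[of _ "{0<..}"]) (auto intro: negligible_subset[of "{0}"])
  qed
  have "?f absolutely_integrable_on (\<lambda>t. c / t) ` {0<..} \<and> integral ((\<lambda>t. c / t) ` {0<..}) ?f = Gamma p"
    unfolding im using hi
    by (auto intro!: nonnegative_absolutely_integrable_1 simp: integral_unique has_integral_integrable)
  then have "(\<lambda>t. \<bar>- c / t\<^sup>2\<bar> * ?f (c / t)) absolutely_integrable_on {0<..} \<and>
       integral {0<..} (\<lambda>t. \<bar>- c / t\<^sup>2\<bar> * ?f (c / t)) = Gamma p"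
    by (subst has_absolute_integral_change_of_variables_1'[OF _ _ inj])
       (auto intro!: derivative_eq_intros simp: power2_eq_square)
  then have hi2: "((\<lambda>t. \<bar>- c / t\<^sup>2\<bar> * ?f (c / t)) has_integral Gamma p) {0<..}"
    using absolutely_integrable_on_def has_integral_iff by blast
  have hi3: "((\<lambda>t. t powr (- p - 1) * exp (- c / t)) has_integral (c powr (- p) * Gamma p)) {0<..}"
  proof (rule has_integral_eq[OF _ has_integral_mult_right[OF hi2, of "c powr (- p)"]])
    fix t :: real assume "t \<in> {0<..}"
    then have t: "0 < t" by simp
    have exps: "- p + 1 + (p - 1) = 0" "- 2 + - (p - 1) = - p - 1" by simp_all
    have "c powr (- p) * (\<bar>- c / t\<^sup>2\<bar> * ?f (c / t)) = c powr (- p) * (c powr 1 * t powr (- 2)) * (c powr (p - 1) * t powr (- (p - 1))) * exp (- c / t)"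
      using t assms by (simp add: powr_minus powr_divide exp_minus divide_simps) (simp flip: powr_add)
    also have "\<dots> = (c powr (- p) * c powr 1 * c powr (p - 1)) * (t powr (- 2) * t powr (- (p - 1))) * exp (- c / t)"
      by (simp add: mult_ac)
    also have "\<dots> = t powr (- p - 1) * exp (- c / t)"
      using t assms by (simp only: powr_add[symmetric] exps) simp
    finally show "c powr (- p) * (\<bar>- c / t\<^sup>2\<bar> * ?f (c / t)) = t powr (- p - 1) * exp (- c / t)" .
  qed
  show ?thesis
    using nn_integral_has_integral_lebesgue[OF _ hi3] by (simp add: mult.commute)
qed

text \<open>Subordination: the powers of \<open>t\<close> combine to the exponent of
  \<open>nn_integral_inverse_Gamma\<close>. At \<open>z = 0\<close> the integral is infinite,
  whereas \<open>riesz_kernel \<alpha> 0\<close> is 0.\<close>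

lemma nn_integral_rl_heat:
  fixes z :: "'a::euclidean_space"
  assumes "0 < \<alpha>" "\<alpha> < real DIM('a)" "z \<noteq> 0"
  shows "(\<integral>\<^sup>+ t. heat t z \<partial>rl_measure (\<alpha> / 2)) = riesz_kernel \<alpha> z"
proof -
  define p where "p = (real DIM('a) - \<alpha>) / 2"
  define c where "c = (norm z)\<^sup>2 / 4"
  define C where "C = (4 * pi) powr (- real DIM('a) / 2) / Gamma (\<alpha> / 2)"
  have p: "0 < p" and c: "0 < c" and C: "0 \<le> C" using assms by (auto simp: p_def c_def C_def)
  have "(\<integral>\<^sup>+ t. heat t z \<partial>rl_measure (\<alpha> / 2)) =
     (\<integral>\<^sup>+ t. ennreal C * ennreal (indicator {0<..} t * (t powr (- p - 1) * exp (- c / t))) \<partial>lborel)"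
  proof (subst nn_integral_rl, measurable, intro nn_integral_cong)
    fix t :: real
    show "ennreal (indicator {0<..} t * t powr (\<alpha> / 2 - 1) / Gamma (\<alpha> / 2)) * ennreal (heat t z)
      = ennreal C * ennreal (indicator {0<..} t * (t powr (- p - 1) * exp (- c / t)))"
    proof (cases "0 < t")
      case True
      have "t powr (\<alpha> / 2 - 1) * t powr (- real DIM('a) / 2) = t powr (- p - 1)"
        unfolding powr_add[symmetric] by (rule arg_cong[of _ _ "(powr) t"]) (simp add: p_def field_simps)
      then have "t powr (\<alpha> / 2 - 1) / Gamma (\<alpha> / 2) * heat t z = C * (t powr (- p - 1) * exp (- c / t))"
        using True by (simp add: heat_def C_def c_def powr_mult mult_ac)
      with True C show ?thesis
        using assms by (simp add: ennreal_mult''[symmetric])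
    qed simp
  qed
  also have "\<dots> = ennreal (C * (Gamma p * c powr (- p)))"
    using C p c by (subst nn_integral_cmult) (simp_all only: nn_integral_inverse_Gamma ennreal_mult', measurable)
  also have "C * (Gamma p * c powr (- p)) = riesz_kernel \<alpha> z"
  proof -
    have "c = (norm z) powr 2 / 2 powr 2"
      using assms by (simp add: c_def powr_numeral)
    then have "c powr (- p) = norm z powr (\<alpha> - DIM('a)) / 2 powr (\<alpha> - DIM('a))"
      using assms by (simp only: powr_divide powr_powr norm_ge_zero) (simp add: p_def powr_divide powr_powr diff_divide_distrib)
    moreover have "(4 * pi) powr (- real DIM('a) / 2) = 1 / (2 powr DIM('a) * pi powr (real DIM('a) / 2))"
    proof -
      have "(4 :: real) = 2 powr 2" by simp
      then have "(4 :: real) powr (- real DIM('a) / 2) = 2 powr (- real DIM('a))"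
        by (metis powr_powr mult.commute nonzero_mult_div_cancel_right times_divide_eq_left zero_neq_numeral)
      then show ?thesis by (simp add: powr_mult powr_minus_divide)
    qed
    ultimately show ?thesis
      by (simp add: C_def riesz_kernel_def p_def powr_diff)
  qed
  finally show ?thesis .
qed

text \<open>Both kernels are superpositions of heat kernels. After Tonelli, the heat semigroup
  merges the factors and \<open>nn_integral_rl_convolution\<close> merges the two time integrals
  into a single subordination.\<close>

lemma nn_integral_riesz_kernel_convolution:
  fixes x y :: "'a::euclidean_space"
  assumes "0 < \<alpha>" "0 < \<beta>" "\<alpha> + \<beta> < real DIM('a)" "x \<noteq> y"
  shows "(\<integral>\<^sup>+ z. ennreal (riesz_kernel \<alpha> (x - z) * riesz_kernel \<beta> (z - y)) \<partial>lborel) = riesz_kernel (\<alpha> + \<beta>) (x - y)"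
proof -
  interpret a: sigma_finite_measure "rl_measure (\<alpha> / 2)" by (rule sigma_finite_rl)
  interpret b: sigma_finite_measure "rl_measure (\<beta> / 2)" by (rule sigma_finite_rl)
  interpret pa: pair_sigma_finite "rl_measure (\<alpha> / 2)" "lborel :: 'a measure" ..
  interpret pb: pair_sigma_finite "rl_measure (\<beta> / 2)" "lborel :: 'a measure" ..
  have "(\<integral>\<^sup>+ z. ennreal (riesz_kernel \<alpha> (x - z) * riesz_kernel \<beta> (z - y)) \<partial>lborel) =
     (\<integral>\<^sup>+ z. (\<integral>\<^sup>+ s. (\<integral>\<^sup>+ t. ennreal (heat s (x - z)) * ennreal (heat t (z - y)) \<partial>rl_measure (\<beta> / 2)) \<partial>rl_measure (\<alpha> / 2)) \<partial>lborel)"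
  proof (rule nn_integral_cong_AE)
    \<comment> \<open>Subordination fails at the singularities of the two kernels, which form a null
      set.\<close>
    have "AE z in lborel. z \<noteq> x" "AE z in lborel. z \<noteq> y" by (rule AE_lborel_singleton)+
    then show "AE z in lborel. ennreal (riesz_kernel \<alpha> (x - z) * riesz_kernel \<beta> (z - y)) =
       (\<integral>\<^sup>+ s. (\<integral>\<^sup>+ t. ennreal (heat s (x - z)) * ennreal (heat t (z - y)) \<partial>rl_measure (\<beta> / 2)) \<partial>rl_measure (\<alpha> / 2))"
    proof eventually_elim
      case (elim z)
      have "ennreal (riesz_kernel \<alpha> (x - z) * riesz_kernel \<beta> (z - y)) =
        (\<integral>\<^sup>+ s. heat s (x - z) \<partial>rl_measure (\<alpha> / 2)) * (\<integral>\<^sup>+ t. heat t (z - y) \<partial>rl_measure (\<beta> / 2))"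
        using assms elim by (simp add: nn_integral_rl_heat ennreal_mult')
      also have "\<dots> = (\<integral>\<^sup>+ s. (\<integral>\<^sup>+ t. ennreal (heat s (x - z)) * ennreal (heat t (z - y)) \<partial>rl_measure (\<beta> / 2)) \<partial>rl_measure (\<alpha> / 2))"
        by (subst nn_integral_multc[symmetric], measurable) (simp add: nn_integral_cmult)
      finally show ?case .
    qed
  qed
  also have "\<dots> = (\<integral>\<^sup>+ s. (\<integral>\<^sup>+ z. (\<integral>\<^sup>+ t. ennreal (heat s (x - z)) * ennreal (heat t (z - y)) \<partial>rl_measure (\<beta> / 2)) \<partial>lborel) \<partial>rl_measure (\<alpha> / 2))"
    by (rule pa.Fubini') measurable
  also have "\<dots> = (\<integral>\<^sup>+ s. (\<integral>\<^sup>+ t. (\<integral>\<^sup>+ z. ennreal (heat s (x - z)) * ennreal (heat t (z - y)) \<partial>lborel) \<partial>rl_measure (\<beta> / 2)) \<partial>rl_measure (\<alpha> / 2))"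
    by (intro nn_integral_cong pb.Fubini') measurable
  also have "\<dots> = (\<integral>\<^sup>+ s. (\<integral>\<^sup>+ t. ennreal (heat (s + t) (x - y)) \<partial>rl_measure (\<beta> / 2)) \<partial>rl_measure (\<alpha> / 2))"
  proof -
    \<comment> \<open>The semigroup law is available for positive times, which carry all the mass of
      \<open>rl_measure\<close>.\<close>
    have "AE s in rl_measure (\<alpha> / 2). AE t in rl_measure (\<beta> / 2). (\<integral>\<^sup>+ z. ennreal (heat s (x - z)) * ennreal (heat t (z - y)) \<partial>lborel) = ennreal (heat (s + t) (x - y))"
      using AE_rl
    proof eventually_elim
      case (elim s)
      show ?case using AE_rl
        by eventually_elim (use elim in \<open>simp add: nn_integral_heat_convolution ennreal_mult''[symmetric]\<close>)
    qed
    then have "AE s in rl_measure (\<alpha> / 2). (\<integral>\<^sup>+ t. (\<integral>\<^sup>+ z. ennreal (heat s (x - z)) * ennreal (heat t (z - y)) \<partial>lborel) \<partial>rl_measure (\<beta> / 2)) = (\<integral>\<^sup>+ t. ennreal (heat (s + t) (x - y)) \<partial>rl_measure (\<beta> / 2))"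
      by eventually_elim (rule nn_integral_cong_AE)
    then show ?thesis by (rule nn_integral_cong_AE)
  qed
  also have "\<dots> = (\<integral>\<^sup>+ v. ennreal (heat v (x - y)) \<partial>rl_measure (\<alpha> / 2 + \<beta> / 2))"
    using assms by (intro nn_integral_rl_convolution) auto
  also have "\<dots> = riesz_kernel (\<alpha> + \<beta>) (x - y)"
    using nn_integral_rl_heat[of "\<alpha> + \<beta>" "x - y"] assms by (simp add: add_divide_distrib)
  finally show ?thesis .
qed

subsection \<open>Parameter integrals\<close>

text \<open>Mean value bound on the ball of radius \<open>norm z\<close>, where the derivative is at
  most \<open>exp (norm z)\<close>.\<close>

lemma norm_exp_minus_one_le: "norm (exp z - 1) \<le> norm z * exp (norm z)" for z :: complex
proof -
  have "norm (exp z - exp 0) \<le> exp (norm z) * norm (z - 0)"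
  proof (rule field_differentiable_bound[of "cball 0 (norm z)" exp exp])
    fix w :: complex assume "w \<in> cball 0 (norm z)"
    then show "norm (exp w) \<le> exp (norm z)"
      using norm_exp[of w] by (meson exp_le_cancel_iff mem_cball_0 order_trans)
  qed (auto intro: DERIV_subset[OF DERIV_exp])
  then show ?thesis by (simp add: mult.commute)
qed

text \<open>Differentiation under the integral. Integrability at real parameters is enough, since
  the modulus of the exponential depends on \<open>Re \<beta>\<close> only. With \<open>l\<close> a
  logarithm this covers the power weights both in time and in space.\<close>

lemma holomorphic_on_integral_exp:
  fixes l :: "'a \<Rightarrow> real" and w :: "'a \<Rightarrow> complex"
  assumes [measurable]: "l \<in> borel_measurable M" "w \<in> borel_measurable M"
    and int: "\<And>s. a < s \<Longrightarrow> s < b \<Longrightarrow> integrable M (\<lambda>x. of_real (exp (s * l x)) * w x)"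
  shows "(\<lambda>\<beta>. LINT x|M. exp (\<beta> * of_real (l x)) * w x) holomorphic_on {\<beta>. a < Re \<beta> \<and> Re \<beta> < b}"
proof -
  let ?S = "{\<beta>. a < Re \<beta> \<and> Re \<beta> < b}"
  let ?e = "\<lambda>\<beta> x. exp (\<beta> * of_real (l x)) * w x"
  have intc: "integrable M (?e \<beta>)" if "\<beta> \<in> ?S" for \<beta>
    by (rule Bochner_Integration.integrable_bound[OF int[of "Re \<beta>"]]) (use that in \<open>auto simp: norm_mult\<close>)
  have "(\<lambda>\<beta>. LINT x|M. ?e \<beta> x) field_differentiable at \<beta>" if \<beta>: "\<beta> \<in> ?S" for \<beta>
  proof -
    \<comment> \<open>the factor \<open>\<bar>l x\<bar>\<close> produced by differentiation costs one \<open>\<eta>\<close>, the increment of \<open>\<beta>\<close> another\<close>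
    define \<eta> where "\<eta> = min (Re \<beta> - a) (b - Re \<beta>) / 3"
    have \<eta>: "0 < \<eta>" "a < Re \<beta> - 2 * \<eta>" "Re \<beta> + 2 * \<eta> < b" using \<beta> by (auto simp: \<eta>_def min_def field_simps)
    \<comment> \<open>The two exponents cover the two signs of \<open>l x\<close>; the factor
      \<open>1 / \<eta>\<close> comes from \<open>\<eta> * \<bar>l x\<bar> \<le> exp (\<eta> *
      \<bar>l x\<bar>)\<close>.\<close>
    define B where "B x = 1 / \<eta> * (norm (of_real (exp ((Re \<beta> + 2 * \<eta>) * l x)) * w x) + norm (of_real (exp ((Re \<beta> - 2 * \<eta>) * l x)) * w x))" for x
    have B: "integrable M B"
      unfolding B_def using \<eta> by (intro integrable_mult_right Bochner_Integration.integrable_add integrable_norm int) auto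
    let ?D = "\<lambda>x. of_real (l x) * ?e \<beta> x"
    have "((\<lambda>\<beta>. LINT x|M. ?e \<beta> x) has_field_derivative (LINT x|M. ?D x)) (at \<beta> within ball \<beta> \<eta>)"
      unfolding has_field_derivative_iff tendsto_at_iff_sequentially
    proof safe
      fix X :: "nat \<Rightarrow> complex"
      assume X: "\<forall>i. X i \<in> ball \<beta> \<eta> - {\<beta>}" "X \<longlonglongrightarrow> \<beta>"
      have XS: "X i \<in> ?S" for i
      proof -
        have "\<bar>Re (X i - \<beta>)\<bar> < \<eta>" using X(1)[rule_format, of i] abs_Re_le_cmod[of "X i - \<beta>"]
          by (simp add: dist_norm norm_minus_commute)
        with \<eta> show ?thesis by (auto simp: abs_if split: if_splits)
      qed
      have "(\<lambda>i. LINT x|M. (?e (X i) x - ?e \<beta> x) / (X i - \<beta>)) \<longlonglongrightarrow> (LINT x|M. ?D x)"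
      proof (rule integral_dominated_convergence[where w = B])
        show "AE x in M. (\<lambda>i. (?e (X i) x - ?e \<beta> x) / (X i - \<beta>)) \<longlonglongrightarrow> ?D x"
        proof (rule AE_I2)
          fix x
          have "((\<lambda>\<beta>. ?e \<beta> x) has_field_derivative ?D x) (at \<beta>)"
            by (auto intro!: derivative_eq_intros)
          then have "((\<lambda>y. (?e y x - ?e \<beta> x) / (y - \<beta>)) \<longlongrightarrow> ?D x) (at \<beta>)"
            by (simp add: has_field_derivative_iff)
          then show "(\<lambda>i. (?e (X i) x - ?e \<beta> x) / (X i - \<beta>)) \<longlonglongrightarrow> ?D x"
            using X by (auto simp: tendsto_at_iff_sequentially comp_def)
        qed
        show "AE x in M. norm ((?e (X i) x - ?e \<beta> x) / (X i - \<beta>)) \<le> B x" for i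
        proof (rule AE_I2)
          fix x
          define h where "h = X i - \<beta>"
          have h: "h \<noteq> 0" "norm h \<le> \<eta>" using X(1)[rule_format, of i]
            by (auto simp: h_def dist_norm norm_minus_commute)
          have "?e (X i) x - ?e \<beta> x = ?e \<beta> x * (exp (h * of_real (l x)) - 1)"
            by (simp add: h_def algebra_simps exp_diff exp_add)
          then have "norm ((?e (X i) x - ?e \<beta> x) / (X i - \<beta>)) = norm (?e \<beta> x) * (norm (exp (h * of_real (l x)) - 1) / norm h)"
            by (simp add: h_def norm_mult norm_divide)
          also have "\<dots> \<le> norm (?e \<beta> x) * (1 / \<eta> * exp (2 * \<eta> * \<bar>l x\<bar>))"
          proof (rule mult_left_mono)
            have "norm (exp (h * of_real (l x)) - 1) / norm h \<le> (norm (h * of_real (l x)) * exp (norm (h * of_real (l x)))) / norm h"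
              by (intro divide_right_mono norm_exp_minus_one_le) simp
            also have "\<dots> = \<bar>l x\<bar> * exp (norm h * \<bar>l x\<bar>)"
              using h by (simp add: norm_mult)
            also have "\<dots> \<le> (1 / \<eta> * exp (\<eta> * \<bar>l x\<bar>)) * exp (\<eta> * \<bar>l x\<bar>)"
            proof (intro mult_mono)
              have "\<eta> * \<bar>l x\<bar> \<le> exp (\<eta> * \<bar>l x\<bar>)"
                using exp_ge_add_one_self[of "\<eta> * \<bar>l x\<bar>"] by linarith
              then show "\<bar>l x\<bar> \<le> 1 / \<eta> * exp (\<eta> * \<bar>l x\<bar>)" using \<eta> by (simp add: field_simps)
            qed (use \<eta> h in \<open>auto intro: mult_right_mono\<close>)
            also have "\<dots> = 1 / \<eta> * exp (2 * \<eta> * \<bar>l x\<bar>)"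
              by (simp flip: exp_add)
            finally show "norm (exp (h * of_real (l x)) - 1) / norm h \<le> 1 / \<eta> * exp (2 * \<eta> * \<bar>l x\<bar>)" .
          qed simp
          also have "\<dots> \<le> B x"
          proof -
            have "exp (Re \<beta> * l x) * exp (2 * \<eta> * \<bar>l x\<bar>) \<le> exp ((Re \<beta> + 2 * \<eta>) * l x) + exp ((Re \<beta> - 2 * \<eta>) * l x)"
              by (cases "0 \<le> l x") (auto simp: exp_add[symmetric] algebra_simps)
            then have "1 / \<eta> * (exp (Re \<beta> * l x) * exp (2 * \<eta> * \<bar>l x\<bar>)) * norm (w x)
               \<le> 1 / \<eta> * (exp ((Re \<beta> + 2 * \<eta>) * l x) + exp ((Re \<beta> - 2 * \<eta>) * l x)) * norm (w x)"
              using \<eta> by (intro mult_left_mono mult_right_mono) auto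
            then show ?thesis by (simp add: B_def norm_mult algebra_simps)
          qed
          finally show "norm ((?e (X i) x - ?e \<beta> x) / (X i - \<beta>)) \<le> B x" .
        qed
      qed (use B in auto)
      also have "(\<lambda>i. LINT x|M. (?e (X i) x - ?e \<beta> x) / (X i - \<beta>)) =
         (\<lambda>y. ((LINT x|M. ?e y x) - (LINT x|M. ?e \<beta> x)) / (y - \<beta>)) \<circ> X"
        using intc[OF XS] intc[OF \<beta>] by (simp add: fun_eq_iff)
      finally show "((\<lambda>y. ((LINT x|M. ?e y x) - (LINT x|M. ?e \<beta> x)) / (y - \<beta>)) \<circ> X) \<longlonglongrightarrow> (LINT x|M. ?D x)" .
    qed
    then have "((\<lambda>\<beta>. LINT x|M. ?e \<beta> x) has_field_derivative (LINT x|M. ?D x)) (at \<beta>)"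
      using at_within_open[of \<beta> "ball \<beta> \<eta>"] \<eta> by simp
    then show ?thesis by (auto simp: field_differentiable_def)
  qed
  then show ?thesis
    by (auto simp: holomorphic_on_def intro: field_differentiable_at_within)
qed

text \<open>Since \<open>h\<close> is nonnegative, the integral of the modulus over the product is
  that of \<open>K y * norm (f y)\<close>, which is finite, so Fubini applies. Used with space as
  parameter to compose Riesz kernels and with time as parameter for the heat flow.\<close>

lemma integral_kernel_superposition:
  fixes h :: "'b \<Rightarrow> 'a::euclidean_space \<Rightarrow> real" and f :: "'a \<Rightarrow> complex"
  assumes M: "sigma_finite_measure M"
    and h [measurable]: "(\<lambda>(s, y). h s y) \<in> borel_measurable (M \<Otimes>\<^sub>M borel)"
    and f [measurable]: "f \<in> borel_measurable borel"
    and h0: "\<And>s y. 0 \<le> h s y" and K0: "\<And>y. 0 \<le> K y"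
    and K: "AE y in lborel. (\<integral>\<^sup>+ s. h s y \<partial>M) = ennreal (K y)"
    and int: "integrable lborel (\<lambda>y. of_real (K y) * f y)"
  shows "integrable M (\<lambda>s. LINT y|lborel. of_real (h s y) * f y)"
    and "(LINT s|M. LINT y|lborel. of_real (h s y) * f y) = (LINT y|lborel. of_real (K y) * f y)"
proof -
  interpret sigma_finite_measure M by fact
  interpret P: pair_sigma_finite M "lborel :: 'a measure" ..
  have m: "(\<lambda>(s, y). of_real (h s y) * f y) \<in> borel_measurable (M \<Otimes>\<^sub>M lborel)"
    by measurable
  have "(\<integral>\<^sup>+ p. ennreal (norm (case p of (s, y) \<Rightarrow> of_real (h s y) * f y)) \<partial>(M \<Otimes>\<^sub>M lborel))
      = (\<integral>\<^sup>+ y. (\<integral>\<^sup>+ s. ennreal (norm (of_real (h s y) * f y)) \<partial>M) \<partial>lborel)"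
    by (subst P.nn_integral_snd[symmetric]) auto
  also have "\<dots> = (\<integral>\<^sup>+ y. ennreal (norm (of_real (K y) * f y)) \<partial>lborel)"
  proof (rule nn_integral_cong_AE)
    show "AE y in lborel. (\<integral>\<^sup>+ s. ennreal (norm (of_real (h s y) * f y)) \<partial>M) = ennreal (norm (of_real (K y) * f y))"
      using K
    proof eventually_elim
      case (elim y)
      have "(\<integral>\<^sup>+ s. ennreal (norm (of_real (h s y) * f y)) \<partial>M) = (\<integral>\<^sup>+ s. ennreal (h s y) * ennreal (norm (f y)) \<partial>M)"
        using h0 by (intro nn_integral_cong) (simp add: norm_mult ennreal_mult')
      also have "\<dots> = ennreal (K y) * ennreal (norm (f y))"
        by (subst nn_integral_multc) (auto simp: elim)
      finally show ?case using K0 by (simp add: norm_mult ennreal_mult')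
    qed
  qed
  also have "\<dots> < \<infinity>" using int by (simp add: integrable_iff_bounded)
  finally have I: "integrable (M \<Otimes>\<^sub>M lborel) (\<lambda>(s, y). of_real (h s y) * f y)"
    using m by (simp add: integrable_iff_bounded)
  show "integrable M (\<lambda>s. LINT y|lborel. of_real (h s y) * f y)"
    using P.integrable_fst'[OF I] by simp
  have "(LINT s|M. LINT y|lborel. of_real (h s y) * f y) = (LINT y|lborel. LINT s|M. of_real (h s y) * f y)"
    by (rule P.Fubini_integral[symmetric]) (rule I)
  also have "\<dots> = (LINT y|lborel. of_real (K y) * f y)"
  proof (rule integral_cong_AE)
    show "AE y in lborel. (LINT s|M. of_real (h s y) * f y) = of_real (K y) * f y"
      using K
    proof eventually_elim
      case (elim y)
      have "integrable M (\<lambda>s. h s y)" "(LINT s|M. h s y) = K y"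
        using elim h0 K0 by (auto simp: integrable_iff_bounded integral_eq_nn_integral)
      then show ?case by (simp del: of_real_mult)
    qed
  next
    show "(\<lambda>y. of_real (K y) * f y) \<in> borel_measurable lborel"
      using int by (rule borel_measurable_integrable)
  qed measurable
  finally show "(LINT s|M. LINT y|lborel. of_real (h s y) * f y) = (LINT y|lborel. of_real (K y) * f y)" .
qed

lemma integral_norm_bound_AE:
  fixes f :: "'a \<Rightarrow> 'b::{banach, second_countable_topology}"
  assumes "integrable M g" "AE x in M. norm (f x) \<le> g x" "integrable M f"
  shows "norm (integral\<^sup>L M f) \<le> integral\<^sup>L M g"
  using integral_norm_bound[of M f] integral_mono_AE[OF integrable_norm[OF assms(3)] assms(1,2)]
  by linarith

subsection \<open>Riesz potentials of real order\<close>

lemma decay_space_mono: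
  assumes "f \<in> decay_space a" "b \<le> a"
  shows "f \<in> decay_space b"
proof -
  have "(\<lambda>x. norm (f x)) \<in> O[at_infinity](\<lambda>x. norm x powr (- b))"
  proof (rule landau_o.big.trans)
    show "(\<lambda>x. norm (f x)) \<in> O[at_infinity](\<lambda>x. norm x powr (- a))"
      using assms by (simp add: decay_space_def)
    have "eventually (\<lambda>x :: real ^ 'a. norm x \<ge> 1) at_infinity"
      by (auto simp: eventually_at_infinity)
    then show "(\<lambda>x :: real ^ 'a. norm x powr (- a)) \<in> O[at_infinity](\<lambda>x. norm x powr (- b))"
      by (intro bigoI[of _ 1]) (auto elim!: eventually_mono intro!: powr_mono simp: assms)
  qed
  then show ?thesis using assms by (simp add: decay_space_def)
qed

text \<open>Compactness gives a bound on a ball, the decay one outside. The weight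
  \<open>1 + norm y\<close> has no singularity, so one constant serves everywhere.\<close>

lemma decay_space_bound:
  assumes "f \<in> decay_space a" "0 \<le> a"
  obtains D where "0 \<le> D" "\<And>y. norm (f y) \<le> D * (1 + norm y) powr (- a)"
proof -
  have cont: "continuous_on UNIV f" and "(\<lambda>x. norm (f x)) \<in> O[at_infinity](\<lambda>x. norm x powr (- a))"
    using assms by (auto simp: decay_space_def)
  then obtain c where c: "0 < c" "eventually (\<lambda>x. norm (f x) \<le> c * norm (norm x powr (- a))) at_infinity"
    by (auto elim: landau_o.bigE)
  then obtain R0 where R0: "\<And>x. R0 \<le> norm x \<Longrightarrow> norm (f x) \<le> c * norm x powr (- a)"
    by (auto simp: eventually_at_infinity)
  define R where "R = max 1 R0"
  have "compact (f ` cball 0 R)"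
    by (intro compact_continuous_image continuous_on_subset[OF cont]) auto
  then obtain B where B: "\<And>x. norm x \<le> R \<Longrightarrow> norm (f x) \<le> B"
    by (meson bounded_iff compact_imp_bounded image_eqI mem_cball_0)
  have B0: "0 \<le> B" using order_trans[OF norm_ge_zero B[of 0]] by (simp add: R_def)
  have R: "1 \<le> R" "R0 \<le> R" by (auto simp: R_def)
  show thesis
  proof
    \<comment> \<open>The first summand serves \<open>norm y \<ge> R\<close>, where
      \<open>R \<ge> 1\<close> gives \<open>1 + norm y \<le> 2 * norm y\<close>; the second serves
      the ball, where \<open>1 + norm y \<le> 1 + R\<close>.\<close>
    show "0 \<le> c * 2 powr a + B * (1 + R) powr a" using c B0 by simp
    fix y
    show "norm (f y) \<le> (c * 2 powr a + B * (1 + R) powr a) * (1 + norm y) powr (- a)"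
    proof (cases "R \<le> norm y")
      case True
      then have "1 \<le> norm y" using R by linarith
      then have "((1 + norm y) / 2) powr a \<le> norm y powr a"
        using assms by (intro powr_mono2) auto
      then have "norm y powr (- a) \<le> 2 powr a * (1 + norm y) powr (- a)"
        using \<open>1 \<le> norm y\<close> by (simp add: powr_minus powr_divide divide_simps mult.commute)
      then have "c * norm y powr (- a) \<le> c * (2 powr a * (1 + norm y) powr (- a))"
        using c by (intro mult_left_mono) auto
      moreover have "norm (f y) \<le> c * norm y powr (- a)" using R0 R True by auto
      moreover have "0 \<le> B * (1 + R) powr a * (1 + norm y) powr (- a)" using B0 by simp
      ultimately show ?thesis by (simp add: algebra_simps)
    next
      case False
      have "B * 1 \<le> B * (((1 + R) / (1 + norm y)) powr a)"
        using False R assms B0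
        by (intro mult_left_mono ge_one_powr_ge_zero) (auto simp: le_divide_eq add_pos_nonneg)
      then have "B \<le> B * (1 + R) powr a * (1 + norm y) powr (- a)"
        using R by (simp add: powr_divide powr_minus divide_simps)
      moreover have "norm (f y) \<le> B" using B False by auto
      moreover have "0 \<le> c * 2 powr a * (1 + norm y) powr (- a)" using c by simp
      ultimately show ?thesis by (simp add: algebra_simps)
    qed
  qed
qed

text \<open>A Peetre-type inequality. It recentres the weight at \<open>e\<close> and makes it a
  pure power, to which the convolution formula for Riesz kernels applies.\<close>

lemma powr_one_plus_norm_le:
  fixes y e x :: "'a::real_normed_vector"
  assumes "0 \<le> a" "y \<noteq> e"
  shows "(1 + norm (x - y)) powr (- a) \<le> (1 + norm (x - e)) powr a * norm (y - e) powr (- a)"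
proof -
  have "norm (y - e) \<le> norm (x - y) + norm (x - e)"
    using norm_triangle_ineq4[of "x - e" "x - y"] by simp
  also have "\<dots> \<le> (1 + norm (x - y)) * (1 + norm (x - e))" by (simp add: algebra_simps)
  finally have "norm (y - e) powr a \<le> ((1 + norm (x - y)) * (1 + norm (x - e))) powr a"
    using assms by (intro powr_mono2) auto
  also have "\<dots> = (1 + norm (x - y)) powr a * (1 + norm (x - e)) powr a"
    by (simp add: powr_mult)
  finally show ?thesis using assms by (simp add: powr_minus divide_simps mult.commute)
qed

text \<open>Both powers are multiples of Riesz kernels, of orders \<open>\<gamma>\<close> and
  \<open>CARD('n) - a\<close>. As \<open>\<gamma> < a\<close>, the orders add up to less than the
  dimension, and the convolution is finite off the diagonal.\<close>

lemma integrable_riesz_product: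
  fixes x e :: "real ^ 'n"
  assumes "0 < \<gamma>" "\<gamma> < a" "a < real CARD('n)" "x \<noteq> e"
  shows "integrable lborel (\<lambda>y. norm (x - y) powr (\<gamma> - real CARD('n)) * norm (y - e) powr (- a))"
proof -
  \<comment> \<open>The constant of the Riesz kernel, read off at a unit vector.\<close>
  define k where "k \<alpha> = riesz_kernel \<alpha> (axis undefined 1 :: real ^ 'n)" for \<alpha>
  have pos: "0 < k \<alpha>" and rk: "riesz_kernel \<alpha> z = k \<alpha> * norm z powr (\<alpha> - real CARD('n))"
    if "0 < \<alpha>" "\<alpha> < real CARD('n)" for \<alpha> and z :: "real ^ 'n"
    using that by (auto simp: k_def riesz_kernel_def)
  have "integrable lborel (\<lambda>y. riesz_kernel \<gamma> (x - y) * riesz_kernel (real CARD('n) - a) (y - e))"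
    using nn_integral_riesz_kernel_convolution[of \<gamma> "real CARD('n) - a" x e] assms
    by (simp add: integrable_iff_bounded abs_mult)
  then have "integrable lborel (\<lambda>y. (k \<gamma> * k (real CARD('n) - a)) * (norm (x - y) powr (\<gamma> - real CARD('n)) * norm (y - e) powr (- a)))"
    using assms by (simp add: rk mult_ac)
  then show ?thesis
    using assms pos[of \<gamma>] pos[of "real CARD('n) - a"] by (simp add: integrable_mult_right_iff)
qed

text \<open>The convolution formula gives a constant independent of both points; with
  \<open>e = 0\<close> this yields the decay of potentials.\<close>

lemma integral_riesz_product:
  fixes \<gamma> a :: real
  assumes "0 < \<gamma>" "\<gamma> < a" "a < real CARD('n)"
  obtains C where "0 \<le> C" "\<And>x e :: real ^ 'n. x \<noteq> e \<Longrightarrow> (LINT y|lborel. norm (x - y) powr (\<gamma> - real CARD('n)) * norm (y - e) powr (- a)) \<le> C * norm (x - e) powr (\<gamma> - a)"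
proof -
  define k where "k \<alpha> = riesz_kernel \<alpha> (axis undefined 1 :: real ^ 'n)" for \<alpha>
  have pos: "0 < k \<alpha>" and rk: "riesz_kernel \<alpha> z = k \<alpha> * norm z powr (\<alpha> - real CARD('n))"
    if "0 < \<alpha>" "\<alpha> < real CARD('n)" for \<alpha> and z :: "real ^ 'n"
    using that by (auto simp: k_def riesz_kernel_def)
  let ?b = "real CARD('n) - a"
  have p: "0 < k \<gamma>" "0 < k ?b" "0 < k (\<gamma> + ?b)" using assms by (auto intro!: pos)
  show thesis
  proof
    show "0 \<le> k (\<gamma> + ?b) / (k \<gamma> * k ?b)" using p by simp
    fix x e :: "real ^ 'n" assume "x \<noteq> e"
    have "(LINT y|lborel. riesz_kernel \<gamma> (x - y) * riesz_kernel ?b (y - e)) = riesz_kernel (\<gamma> + ?b) (x - e)"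
      using nn_integral_riesz_kernel_convolution[of \<gamma> ?b x e] assms \<open>x \<noteq> e\<close>
      by (subst integral_eq_nn_integral) auto
    then have "k \<gamma> * k ?b * (LINT y|lborel. norm (x - y) powr (\<gamma> - real CARD('n)) * norm (y - e) powr (- a)) = k (\<gamma> + ?b) * norm (x - e) powr (\<gamma> - a)"
      using assms by (simp add: rk mult_ac flip: integral_mult_right_zero)
    then show "(LINT y|lborel. norm (x - y) powr (\<gamma> - real CARD('n)) * norm (y - e) powr (- a)) \<le> k (\<gamma> + ?b) / (k \<gamma> * k ?b) * norm (x - e) powr (\<gamma> - a)"
      using p by (simp add: field_simps)
  qed
qed

lemma borel_measurable_decay_space: "f \<in> decay_space a \<Longrightarrow> f \<in> borel_measurable borel"
  by (simp add: decay_space_def borel_measurable_continuous_onI)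

lemma integrable_decay_space:
  fixes f :: "real ^ 'n \<Rightarrow> complex"
  assumes f: "f \<in> decay_space a" and "0 < \<gamma>" "\<gamma> < a" "a < real CARD('n)"
  shows "integrable lborel (\<lambda>y. of_real (norm (x - y) powr (\<gamma> - real CARD('n))) * f y)"
proof -
  note [measurable] = borel_measurable_decay_space[OF f]
  obtain D where D: "0 \<le> D" "\<And>y. norm (f y) \<le> D * (1 + norm y) powr (- a)"
    using assms by (auto intro: decay_space_bound[OF f])
  \<comment> \<open>The weight is recentred away from \<open>x\<close>: the two power singularities
    together would not be integrable at a common point.\<close>
  define e where "e = x + axis undefined 1"
  have e: "x \<noteq> e" by (simp add: e_def axis_eq_0_iff)
  show ?thesis
  proof (rule Bochner_Integration.integrable_bound)
    show "integrable lborel (\<lambda>y. (D * (1 + norm (0 - e)) powr a) * (norm (x - y) powr (\<gamma> - real CARD('n)) * norm (y - e) powr (- a)))"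
      using integrable_riesz_product[of \<gamma> a x e] assms e by (intro integrable_mult_right) auto
    have "AE y in lborel. y \<noteq> e" by (rule AE_lborel_singleton)
    then show "AE y in lborel. norm (of_real (norm (x - y) powr (\<gamma> - real CARD('n))) * f y)
       \<le> norm ((D * (1 + norm (0 - e)) powr a) * (norm (x - y) powr (\<gamma> - real CARD('n)) * norm (y - e) powr (- a)))"
    proof eventually_elim
      case (elim y)
      have "norm (f y) \<le> D * ((1 + norm (0 - e)) powr a * norm (y - e) powr (- a))"
        using D powr_one_plus_norm_le[of a y e 0] assms elim
        by (intro order_trans[OF D(2)] mult_left_mono) auto
      then have "norm (x - y) powr (\<gamma> - real CARD('n)) * norm (f y) \<le>
        norm (x - y) powr (\<gamma> - real CARD('n)) * (D * ((1 + norm (0 - e)) powr a * norm (y - e) powr (- a)))"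
        by (intro mult_left_mono) auto
      then show ?case using D(1) by (simp add: norm_mult abs_mult mult_ac)
    qed
  qed measurable
qed

text \<open>Real orders suffice for the composition law, because the identity theorem extends it to
  complex ones.\<close>

definition riesz_pot :: "real \<Rightarrow> (real ^ 'n \<Rightarrow> complex) \<Rightarrow> real ^ 'n \<Rightarrow> complex" where
  "riesz_pot \<gamma> f x = (LINT y|lborel. of_real (riesz_kernel \<gamma> (x - y)) * f y)"

lemma riesz_integral_of_real:
  fixes f :: "real ^ 'n \<Rightarrow> complex"
  shows "riesz_integral (of_real \<gamma>) f x = riesz_pot \<gamma> f x"
proof -
  let ?c = "Gamma ((real CARD('n) - \<gamma>) / 2) / (2 powr \<gamma> * pi powr (real CARD('n) / 2) * Gamma (\<gamma> / 2))"
  have c: "1 / riesz_const CARD('n) (of_real \<gamma>) = of_real ?c"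
  proof -
    have "(2 :: complex) powr of_real \<gamma> = of_real (2 powr \<gamma>)"
      using powr_of_real[of 2 \<gamma>] by simp
    moreover have "Gamma (of_real \<gamma> / 2 :: complex) = of_real (Gamma (\<gamma> / 2))"
      using Gamma_complex_of_real[of "\<gamma> / 2"] by simp
    moreover have "Gamma ((of_nat CARD('n) - of_real \<gamma>) / 2 :: complex) = of_real (Gamma ((real CARD('n) - \<gamma>) / 2))"
      using Gamma_complex_of_real[of "(real CARD('n) - \<gamma>) / 2"] by simp
    ultimately show ?thesis by (simp add: riesz_const_def)
  qed
  have "of_real (norm (x - y)) powr (of_real \<gamma> - of_nat CARD('n)) = (of_real (norm (x - y) powr (\<gamma> - real CARD('n))) :: complex)" for y
    using powr_of_real[of "norm (x - y)" "\<gamma> - real CARD('n)"] by simp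
  then have "riesz_integral (of_real \<gamma>) f x = of_real ?c * (LINT y|lborel. f y * of_real (norm (x - y) powr (\<gamma> - real CARD('n))))"
    unfolding riesz_integral_def c by simp
  also have "\<dots> = (LINT y|lborel. of_real ?c * (f y * of_real (norm (x - y) powr (\<gamma> - real CARD('n)))))"
    by (rule integral_mult_right_zero[symmetric])
  also have "\<dots> = riesz_pot \<gamma> f x"
    unfolding riesz_pot_def riesz_kernel_def by (intro Bochner_Integration.integral_cong) (simp_all add: mult_ac)
  finally show ?thesis .
qed

lemma integrable_riesz_kernel:
  fixes f :: "real ^ 'n \<Rightarrow> complex"
  assumes f: "f \<in> decay_space a" and "0 < \<gamma>" "\<gamma> < a" "a < real CARD('n)"
  shows "integrable lborel (\<lambda>y. of_real (riesz_kernel \<gamma> (x - y)) * f y)"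
  unfolding riesz_kernel_def of_real_mult mult.assoc DIM_cart DIM_real mult_1_right
  by (intro integrable_mult_right) (use integrable_decay_space[OF assms] in simp)

lemma riesz_pot_eq:
  fixes f :: "real ^ 'n \<Rightarrow> complex"
  shows "riesz_pot \<gamma> f x = of_real (Gamma ((real CARD('n) - \<gamma>) / 2) / (2 powr \<gamma> * pi powr (real CARD('n) / 2) * Gamma (\<gamma> / 2)))
    * (LINT y|lborel. of_real (norm (x - y) powr (\<gamma> - real CARD('n))) * f y)"
proof -
  let ?c = "Gamma ((real CARD('n) - \<gamma>) / 2) / (2 powr \<gamma> * pi powr (real CARD('n) / 2) * Gamma (\<gamma> / 2))"
  have "of_real (riesz_kernel \<gamma> (x - y)) * f y = of_real ?c * (of_real (norm (x - y) powr (\<gamma> - real CARD('n))) * f y)" for y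
    by (simp only: riesz_kernel_def DIM_cart DIM_real mult_1_right of_real_mult mult.assoc)
  then show ?thesis
    unfolding riesz_pot_def by (simp only: integral_mult_right_zero)
qed

text \<open>Continuity follows by dominated convergence, the decay by comparing \<open>f\<close>
  with \<open>norm y powr (- a)\<close> and applying \<open>integral_riesz_product\<close>.\<close>

lemma riesz_pot_decay_space:
  fixes f :: "real ^ 'n \<Rightarrow> complex"
  assumes f: "f \<in> decay_space a" and \<gamma>: "0 < \<gamma>" "\<gamma> < a" "a < real CARD('n)"
  shows "riesz_pot \<gamma> f \<in> decay_space (a - \<gamma>)"
proof -
  note [measurable] = borel_measurable_decay_space[OF f]
  define P where "P x = (LINT y|lborel. of_real (norm (x - y) powr (\<gamma> - real CARD('n))) * f y)" for x
  define c where "c = Gamma ((real CARD('n) - \<gamma>) / 2) / (2 powr \<gamma> * pi powr (real CARD('n) / 2) * Gamma (\<gamma> / 2))"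
  have rP: "riesz_pot \<gamma> f = (\<lambda>x. of_real c * P x)"
    by (rule ext) (simp only: riesz_pot_eq P_def c_def)
  obtain D where D: "0 \<le> D" "\<And>y. norm (f y) \<le> D * (1 + norm y) powr (- a)"
    using assms by (auto intro: decay_space_bound[OF f])
  have cont: "continuous_on UNIV P"
    unfolding continuous_on_sequentially
  proof safe
    fix X x assume X: "X \<longlonglongrightarrow> (x :: real ^ 'n)"
    \<comment> \<open>any point other than the singularity \<open>0\<close> of the kernel serves as centre of the dominating function\<close>
    define e where "e = (axis undefined 1 :: real ^ 'n)"
    have e: "0 \<noteq> e" using axis_eq_0_iff[of undefined "1::real"] by (metis e_def zero_neq_one)
    \<comment> \<open>After reflection the singularity is fixed and the point \<open>z\<close>
      enters only through the continuous function \<open>f\<close>.\<close>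
    have P': "P z = (LINT y|lborel. of_real (norm y powr (\<gamma> - real CARD('n))) * f (z - y))" for z
    proof -
      have "P z = (LINT y|distr lborel borel (\<lambda>y. z - y). of_real (norm (z - y) powr (\<gamma> - real CARD('n))) * f y)"
        by (simp only: P_def distr_lborel_reflect)
      also have "\<dots> = (LINT y|lborel. of_real (norm y powr (\<gamma> - real CARD('n))) * f (z - y))"
        by (subst integral_distr) auto
      finally show ?thesis .
    qed
    \<comment> \<open>Boundedness makes the recentring factor uniform in \<open>i\<close>.\<close>
    have "bounded (range X)" using X by (rule convergent_imp_bounded)
    then obtain r where r: "\<And>i. norm (X i) \<le> r" by (auto simp: bounded_iff)
    have "(\<lambda>i. P (X i)) \<longlonglongrightarrow> P x"
      unfolding P'
    proof (rule integral_dominated_convergence)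
      show "integrable lborel (\<lambda>y. (D * (1 + r + norm e) powr a) * (norm (0 - y) powr (\<gamma> - real CARD('n)) * norm (y - e) powr (- a)))"
        using integrable_riesz_product[of \<gamma> a 0 e] assms e by (intro integrable_mult_right) auto
      have cf: "isCont f z" for z
        using f by (simp add: decay_space_def continuous_on_eq_continuous_at)
      show "AE y in lborel. (\<lambda>i. of_real (norm y powr (\<gamma> - real CARD('n))) * f (X i - y)) \<longlonglongrightarrow> of_real (norm y powr (\<gamma> - real CARD('n))) * f (x - y)"
        by (intro AE_I2 tendsto_intros isCont_tendsto_compose[OF cf] X)
      have "AE y in lborel. y \<noteq> e" by (rule AE_lborel_singleton)
      then show "AE y in lborel. norm (of_real (norm y powr (\<gamma> - real CARD('n))) * f (X i - y))
        \<le> (D * (1 + r + norm e) powr a) * (norm (0 - y) powr (\<gamma> - real CARD('n)) * norm (y - e) powr (- a))" for i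
      proof eventually_elim
        case (elim y)
        have "norm (X i - e) \<le> r + norm e" using norm_triangle_ineq4[of "X i" e] r[of i] by linarith
        then have "(1 + norm (X i - e)) powr a \<le> (1 + r + norm e) powr a"
          using assms by (intro powr_mono2) auto
        then have "norm (f (X i - y)) \<le> D * ((1 + r + norm e) powr a * norm (y - e) powr (- a))"
          using D powr_one_plus_norm_le[of a y e "X i"] assms elim
          by (intro order_trans[OF D(2)] mult_left_mono order_trans[OF powr_one_plus_norm_le] mult_right_mono) auto
        then have "norm y powr (\<gamma> - real CARD('n)) * norm (f (X i - y)) \<le>
          norm y powr (\<gamma> - real CARD('n)) * (D * ((1 + r + norm e) powr a * norm (y - e) powr (- a)))"
          by (intro mult_left_mono) auto
        then show ?case by (simp add: norm_mult mult_ac)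
      qed
    qed measurable
    then show "(P \<circ> X) \<longlonglongrightarrow> P x" by (simp add: comp_def)
  qed
  obtain C where C: "0 \<le> C" "\<And>x e :: real ^ 'n. x \<noteq> e \<Longrightarrow> (LINT y|lborel. norm (x - y) powr (\<gamma> - real CARD('n)) * norm (y - e) powr (- a)) \<le> C * norm (x - e) powr (\<gamma> - a)"
    using integral_riesz_product[OF \<gamma>] by blast
  have bound: "norm (P x) \<le> D * C * norm x powr (- (a - \<gamma>))" if x: "x \<noteq> 0" for x
  proof -
    have "norm (P x) \<le> (LINT y|lborel. D * (norm (x - y) powr (\<gamma> - real CARD('n)) * norm (y - 0) powr (- a)))"
      unfolding P_def
    proof (rule integral_norm_bound_AE)
      show "integrable lborel (\<lambda>y. D * (norm (x - y) powr (\<gamma> - real CARD('n)) * norm (y - 0) powr (- a)))"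
        using integrable_riesz_product[of \<gamma> a x 0] assms x by (intro integrable_mult_right) auto
      have "AE y in lborel. y \<noteq> (0 :: real ^ 'n)" by (rule AE_lborel_singleton)
      then show "AE y in lborel. norm (of_real (norm (x - y) powr (\<gamma> - real CARD('n))) * f y) \<le> D * (norm (x - y) powr (\<gamma> - real CARD('n)) * norm (y - 0) powr (- a))"
      proof eventually_elim
        case (elim y)
        have "norm (f y) \<le> D * norm (y - 0) powr (- a)"
          using D powr_one_plus_norm_le[of a y 0 0] assms elim
          by (intro order_trans[OF D(2)] mult_left_mono) auto
        then have "norm (x - y) powr (\<gamma> - real CARD('n)) * norm (f y) \<le> norm (x - y) powr (\<gamma> - real CARD('n)) * (D * norm (y - 0) powr (- a))"
          by (intro mult_left_mono) auto
        then show ?case by (simp add: norm_mult mult_ac)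
      qed
    qed (use integrable_decay_space[OF assms] in auto)
    also have "\<dots> = D * (LINT y|lborel. norm (x - y) powr (\<gamma> - real CARD('n)) * norm (y - 0) powr (- a))"
      by (rule integral_mult_right_zero)
    also have "\<dots> \<le> D * (C * norm (x - 0) powr (\<gamma> - a))"
      using D(1) C(2)[OF x] by (intro mult_left_mono) auto
    finally show ?thesis by simp
  qed
  have "(\<lambda>x. norm (riesz_pot \<gamma> f x)) \<in> O[at_infinity](\<lambda>x. norm x powr (- (a - \<gamma>)))"
  proof (rule bigoI)
    have "eventually (\<lambda>x :: real ^ 'n. x \<noteq> 0) at_infinity"
      by (auto simp: eventually_at_infinity intro!: exI[of _ 1])
    then show "eventually (\<lambda>x. norm (norm (riesz_pot \<gamma> f x)) \<le> (\<bar>c\<bar> * (D * C)) * norm (norm x powr (- (a - \<gamma>)))) at_infinity"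
    proof eventually_elim
      case (elim x)
      show ?case using mult_left_mono[OF bound[OF elim], of "\<bar>c\<bar>"]
        by (simp add: rP norm_mult mult_ac)
    qed
  qed
  moreover have "continuous_on UNIV (riesz_pot \<gamma> f)"
    unfolding rP by (intro continuous_intros cont)
  ultimately show ?thesis by (simp add: decay_space_def)
qed

text \<open>Fubini over the intermediate point \<open>z\<close>; absolute convergence comes from the
  composed kernel, of order \<open>\<beta> + \<gamma> < a\<close>.\<close>

lemma riesz_pot_riesz_pot:
  fixes f :: "real ^ 'n \<Rightarrow> complex"
  assumes f: "f \<in> decay_space a" and "0 < \<beta>" "0 < \<gamma>" "\<beta> + \<gamma> < a" "a < real CARD('n)"
  shows "riesz_pot \<beta> (riesz_pot \<gamma> f) x = riesz_pot (\<beta> + \<gamma>) f x"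
proof -
  note [measurable] = borel_measurable_decay_space[OF f]
  have "(LINT z|lborel. LINT y|lborel. of_real (riesz_kernel \<beta> (x - z) * riesz_kernel \<gamma> (z - y)) * f y) = riesz_pot (\<beta> + \<gamma>) f x"
    unfolding riesz_pot_def
  proof (rule integral_kernel_superposition(2))
    have "AE y in lborel. y \<noteq> x" by (rule AE_lborel_singleton)
    then show "AE y in lborel. (\<integral>\<^sup>+ z. ennreal (riesz_kernel \<beta> (x - z) * riesz_kernel \<gamma> (z - y)) \<partial>lborel) = ennreal (riesz_kernel (\<beta> + \<gamma>) (x - y))"
      by eventually_elim (use assms in \<open>simp add: nn_integral_riesz_kernel_convolution\<close>)
    show "integrable lborel (\<lambda>y. of_real (riesz_kernel (\<beta> + \<gamma>) (x - y)) * f y)"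
      using assms by (intro integrable_riesz_kernel[of f a]) auto
  qed (use assms in \<open>auto intro: sigma_finite_lborel\<close>)
  then show ?thesis
    by (simp add: riesz_pot_def mult.assoc)
qed

subsection \<open>The heat flow and the continuation to order zero\<close>

definition heat_flow :: "(real ^ 'n \<Rightarrow> complex) \<Rightarrow> real ^ 'n \<Rightarrow> real \<Rightarrow> complex" where
  "heat_flow f x t = (LINT y|lborel. of_real (heat t (x - y)) * f y)"

lemma integrable_rl_iff:
  fixes \<phi> :: "real \<Rightarrow> complex"
  assumes "0 < p" and [measurable]: "\<phi> \<in> borel_measurable borel"
  shows "integrable (rl_measure p) \<phi> \<longleftrightarrow> integrable lborel (\<lambda>t. (indicator {0<..} t * t powr (p - 1)) *\<^sub>R \<phi> t)"
proof -
  have G: "0 < Gamma p" using assms by simp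
  have "integrable (rl_measure p) \<phi> \<longleftrightarrow> integrable lborel (\<lambda>t. (indicator {0<..} t * t powr (p - 1) / Gamma p) *\<^sub>R \<phi> t)"
    unfolding rl_measure_def using G by (subst integrable_density) auto
  also have "(\<lambda>t. (indicator {0<..} t * t powr (p - 1) / Gamma p) *\<^sub>R \<phi> t) =
     (\<lambda>t. (1 / Gamma p) *\<^sub>R ((indicator {0<..} t * t powr (p - 1)) *\<^sub>R \<phi> t))"
    by auto
  also have "integrable lborel \<dots> \<longleftrightarrow> integrable lborel (\<lambda>t. (indicator {0<..} t * t powr (p - 1)) *\<^sub>R \<phi> t)"
    (is "integrable _ (\<lambda>t. _ *\<^sub>R ?h t) \<longleftrightarrow> _")
  proof
    assume "integrable lborel (\<lambda>t. (1 / Gamma p) *\<^sub>R ?h t)"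
    then have "integrable lborel (\<lambda>t. Gamma p *\<^sub>R ((1 / Gamma p) *\<^sub>R ?h t))"
      by (rule integrable_scaleR_right)
    also have "(\<lambda>t. Gamma p *\<^sub>R ((1 / Gamma p) *\<^sub>R ?h t)) = ?h"
      using G by (simp add: fun_eq_iff)
    finally show "integrable lborel ?h" .
  qed (intro integrable_scaleR_right)
  finally show ?thesis .
qed

text \<open>The normalisation is expressed by the entire function \<open>rGamma\<close>, which
  survives the passage to order zero, where \<open>Gamma\<close> has a pole.\<close>

lemma integral_rl:
  fixes \<phi> :: "real \<Rightarrow> complex"
  assumes "0 < p" and [measurable]: "\<phi> \<in> borel_measurable borel"
  shows "(LINT t|rl_measure p. \<phi> t) = rGamma (of_real p) * (LINT t|lborel. (indicator {0<..} t * t powr (p - 1)) *\<^sub>R \<phi> t)"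
proof -
  have G: "0 < Gamma p" using assms by simp
  have "(LINT t|rl_measure p. \<phi> t) = (LINT t|lborel. (indicator {0<..} t * t powr (p - 1) / Gamma p) *\<^sub>R \<phi> t)"
    unfolding rl_measure_def using G by (subst integral_density) auto
  also have "(\<lambda>t. (indicator {0<..} t * t powr (p - 1) / Gamma p) *\<^sub>R \<phi> t) =
     (\<lambda>t. (1 / Gamma p) *\<^sub>R ((indicator {0<..} t * t powr (p - 1)) *\<^sub>R \<phi> t))"
    by auto
  also have "(LINT t|lborel. \<dots> t) = (1 / Gamma p) *\<^sub>R (LINT t|lborel. (indicator {0<..} t * t powr (p - 1)) *\<^sub>R \<phi> t)"
    by (rule integral_scaleR_right)
  also have "\<dots> = rGamma (of_real p) * (LINT t|lborel. (indicator {0<..} t * t powr (p - 1)) *\<^sub>R \<phi> t)"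
    by (simp add: scaleR_conv_of_real rGamma_inverse_Gamma Gamma_complex_of_real divide_inverse)
  finally show ?thesis .
qed

lemma borel_measurable_heat_flow [measurable]:
  assumes [measurable]: "f \<in> borel_measurable borel"
  shows "heat_flow f x \<in> borel_measurable borel"
  unfolding heat_flow_def by measurable

text \<open>This is \<open>integral_kernel_superposition\<close> with time as the parameter:
  \<open>rl_measure (\<gamma> / 2)\<close> superposes the heat kernels to the Riesz kernel off
  \<open>y = x\<close>.\<close>

lemma
  fixes f :: "real ^ 'n \<Rightarrow> complex"
  assumes f: "f \<in> decay_space a" and "0 < \<gamma>" "\<gamma> < a" "a < real CARD('n)"
  shows integrable_heat_flow: "integrable (rl_measure (\<gamma> / 2)) (heat_flow f x)"
    and riesz_pot_eq_integral_heat_flow: "riesz_pot \<gamma> f x = (LINT t|rl_measure (\<gamma> / 2). heat_flow f x t)"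
proof -
  note [measurable] = borel_measurable_decay_space[OF f]
  have "AE y in lborel. y \<noteq> x" by (rule AE_lborel_singleton)
  then have K: "AE y in lborel. (\<integral>\<^sup>+ t. ennreal (heat t (x - y)) \<partial>rl_measure (\<gamma> / 2)) = ennreal (riesz_kernel \<gamma> (x - y))"
    by eventually_elim (use assms in \<open>simp add: nn_integral_rl_heat\<close>)
  have int: "integrable lborel (\<lambda>y. of_real (riesz_kernel \<gamma> (x - y)) * f y)"
    using assms by (rule integrable_riesz_kernel)
  have m: "(\<lambda>(t, y). heat t (x - y)) \<in> borel_measurable (rl_measure (\<gamma> / 2) \<Otimes>\<^sub>M borel)"
    by measurable
  show "integrable (rl_measure (\<gamma> / 2)) (heat_flow f x)"
    unfolding heat_flow_def
    by (rule integral_kernel_superposition(1)[OF sigma_finite_rl m _ _ _ K int]) (use assms in auto)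
  show "riesz_pot \<gamma> f x = (LINT t|rl_measure (\<gamma> / 2). heat_flow f x t)"
    unfolding heat_flow_def riesz_pot_def
    by (rule integral_kernel_superposition(2)[OF sigma_finite_rl m _ _ _ K int, symmetric]) (use assms in auto)
qed

lemma
  fixes x :: "'a::euclidean_space"
  assumes "0 < t"
  shows integrable_heat: "integrable lborel (\<lambda>y. heat t (x - y))"
    and integral_heat: "(LINT y|lborel. heat t (x - y)) = 1"
  using nn_integral_heat[OF assms, of x] by (auto simp: integrable_iff_bounded integral_eq_nn_integral)

text \<open>Half of the Gaussian exponent absorbs the power through
  \<open>w powr (\<epsilon> / 2) \<le> exp w\<close>; the other half is the Gaussian at time
  \<open>2 * t\<close>. The power of 2 with exponent \<open>DIM('a) / 2\<close> compares the
  normalisations at the two times.\<close>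

lemma heat_mult_norm_powr_le:
  fixes z :: "'a::euclidean_space"
  assumes t: "0 < t" and e: "0 < \<epsilon>" "\<epsilon> < 1"
  shows "heat t z * norm z powr \<epsilon> \<le> (2 powr (real DIM('a) / 2) * 8 powr (\<epsilon> / 2) * t powr (\<epsilon> / 2)) * heat (2 * t) z"
proof -
  define w where "w = (norm z)\<^sup>2 / (8 * t)"
  have w: "0 \<le> w" using t by (simp add: w_def)
  have "w powr (\<epsilon> / 2) \<le> exp w"
  proof (cases "w \<le> 1")
    case True
    then have "w powr (\<epsilon> / 2) \<le> 1" using w e by (intro powr_le1) auto
    also have "1 \<le> exp w" using w by simp
    finally show ?thesis .
  next
    case False
    then have "w powr (\<epsilon> / 2) \<le> w powr 1" using e by (intro powr_mono) auto
    also have "\<dots> \<le> exp w" using exp_ge_add_one_self[of w] w by (simp add: order_trans[of w "1 + w"])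
    finally show ?thesis .
  qed
  moreover have "norm z powr \<epsilon> = (w * (8 * t)) powr (\<epsilon> / 2)"
  proof (cases "z = 0")
    case False
    have "w * (8 * t) = norm z powr 2" using t False by (simp add: w_def powr_numeral)
    then have "(w * (8 * t)) powr (\<epsilon> / 2) = (norm z powr 2) powr (\<epsilon> / 2)" by (rule arg_cong)
    then show ?thesis unfolding powr_powr by simp
  qed (simp add: w_def)
  ultimately have "norm z powr \<epsilon> \<le> exp w * (8 powr (\<epsilon> / 2) * t powr (\<epsilon> / 2))"
    using t w by (simp add: powr_mult mult_right_mono)
  then have "heat t z * norm z powr \<epsilon> \<le> heat t z * (exp w * (8 powr (\<epsilon> / 2) * t powr (\<epsilon> / 2)))"
    by (intro mult_left_mono) auto
  also have "heat t z * exp w = 2 powr (real DIM('a) / 2) * heat (2 * t) z"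
  proof -
    have "exp (- (norm z)\<^sup>2 / (4 * t)) * exp w = exp (- (norm z)\<^sup>2 / (4 * (2 * t)))"
      unfolding exp_add[symmetric] using t by (simp add: w_def field_simps)
    moreover have "(4 * pi * t) powr (- real DIM('a) / 2) = 2 powr (real DIM('a) / 2) * (4 * pi * (2 * t)) powr (- real DIM('a) / 2)"
    proof -
      have "(4 * pi * (2 * t)) powr (- real DIM('a) / 2) = 2 powr (- real DIM('a) / 2) * (4 * pi * t) powr (- real DIM('a) / 2)"
        using t by (subst powr_mult[symmetric]) (simp_all add: mult_ac)
      moreover have "(2::real) powr (real DIM('a) / 2) * 2 powr (- real DIM('a) / 2) = 1"
        by (simp flip: powr_add)
      ultimately show ?thesis by (simp add: mult.assoc[symmetric])
    qed
    ultimately show ?thesis by (simp only: heat_def mult.assoc)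
  qed
  then have "heat t z * (exp w * (8 powr (\<epsilon> / 2) * t powr (\<epsilon> / 2))) = (2 powr (real DIM('a) / 2) * 8 powr (\<epsilon> / 2) * t powr (\<epsilon> / 2)) * heat (2 * t) z"
    by (simp only: mult.assoc[symmetric]) (simp only: mult_ac)
  finally show ?thesis .
qed

lemma integrable_heat_mult:
  fixes f :: "'a::euclidean_space \<Rightarrow> complex"
  assumes "0 < t" and [measurable]: "f \<in> borel_measurable borel" and B: "\<And>y. norm (f y) \<le> B"
  shows "integrable lborel (\<lambda>y. of_real (heat t (x - y)) * f y)"
proof (rule Bochner_Integration.integrable_bound)
  show "integrable lborel (\<lambda>y. B * heat t (x - y))"
    using integrable_heat[OF assms(1)] by (intro integrable_mult_right) auto
  have "0 \<le> B" using norm_ge_zero B order_trans by blast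
  then show "AE y in lborel. norm (of_real (heat t (x - y)) * f y) \<le> norm (B * heat t (x - y))"
    using B by (intro AE_I2) (auto simp: norm_mult abs_mult mult.commute intro!: mult_right_mono)
qed measurable

text \<open>The heat kernel has mass one, so the difference is an average of
  \<open>f y - f x\<close>, and \<open>heat_mult_norm_powr_le\<close> converts the Hoelder power of
  distance into one of time.\<close>

lemma heat_flow_Hoelder:
  fixes f :: "real ^ 'n \<Rightarrow> complex"
  assumes [measurable]: "f \<in> borel_measurable borel" and B: "\<And>y. norm (f y) \<le> B"
    and \<epsilon>: "0 < \<epsilon>" "\<epsilon> < 1"
    and M: "0 \<le> M" "\<And>y. norm (f y - f x) \<le> M * norm (x - y) powr \<epsilon>"
  obtains C where "0 \<le> C" "\<And>t. 0 < t \<Longrightarrow> norm (heat_flow f x t - f x) \<le> C * t powr (\<epsilon> / 2)"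
proof
  let ?c = "2 powr (real DIM(real ^ 'n) / 2) * 8 powr (\<epsilon> / 2)"
  show "0 \<le> M * ?c" using M by simp
  fix t :: real assume t: "0 < t"
  have "heat_flow f x t - f x = (LINT y|lborel. of_real (heat t (x - y)) * f y) - (LINT y|lborel. of_real (heat t (x - y)) * f x)"
    by (simp add: heat_flow_def integral_heat[OF t])
  also have "\<dots> = (LINT y|lborel. of_real (heat t (x - y)) * f y - of_real (heat t (x - y)) * f x)"
    by (intro Bochner_Integration.integral_diff[symmetric] integrable_heat_mult[OF t _ B] integrable_heat_mult[OF t, of _ "norm (f x)"]) auto
  also have "norm \<dots> \<le> (LINT y|lborel. (M * ?c * t powr (\<epsilon> / 2)) * heat (2 * t) (x - y))"
  proof (rule integral_norm_bound_AE)
    show "integrable lborel (\<lambda>y. (M * ?c * t powr (\<epsilon> / 2)) * heat (2 * t) (x - y))"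
      using t by (intro integrable_mult_right integrable_heat) auto
    show "AE y in lborel. norm (of_real (heat t (x - y)) * f y - of_real (heat t (x - y)) * f x) \<le> (M * ?c * t powr (\<epsilon> / 2)) * heat (2 * t) (x - y)"
    proof (rule AE_I2)
      fix y
      have "norm (of_real (heat t (x - y)) * f y - of_real (heat t (x - y)) * f x) = heat t (x - y) * norm (f y - f x)"
        by (simp add: norm_mult flip: right_diff_distrib)
      also have "\<dots> \<le> heat t (x - y) * (M * norm (x - y) powr \<epsilon>)"
        using M by (intro mult_left_mono) auto
      also have "\<dots> = M * (heat t (x - y) * norm (x - y) powr \<epsilon>)" by simp
      also have "\<dots> \<le> M * ((?c * t powr (\<epsilon> / 2)) * heat (2 * t) (x - y))"
        using M heat_mult_norm_powr_le[OF t \<epsilon>, of "x - y"] by (intro mult_left_mono) auto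
      finally show "norm (of_real (heat t (x - y)) * f y - of_real (heat t (x - y)) * f x) \<le> (M * ?c * t powr (\<epsilon> / 2)) * heat (2 * t) (x - y)"
        by (simp only: mult.assoc)
    qed
  next
    show "integrable lborel (\<lambda>y. of_real (heat t (x - y)) * f y - of_real (heat t (x - y)) * f x)"
      by (intro Bochner_Integration.integrable_diff integrable_heat_mult[OF t _ B] integrable_heat_mult[OF t, of _ "norm (f x)"]) auto
  qed
  also have "\<dots> = M * ?c * t powr (\<epsilon> / 2) * (LINT y|lborel. heat (2 * t) (x - y))"
    by (rule integral_mult_right_zero)
  also have "\<dots> = M * ?c * t powr (\<epsilon> / 2)"
    using t by (simp add: integral_heat)
  finally show "norm (heat_flow f x t - f x) \<le> M * ?c * t powr (\<epsilon> / 2)" .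
qed

text \<open>The Beta integral with second parameter 1; at \<open>p = \<gamma> / 2\<close> it
  evaluates the term split off in \<open>heat_flow_continuation\<close>.\<close>

lemma
  assumes "0 < p"
  shows integrable_powr_01: "integrable lborel (\<lambda>t::real. indicator {0<..<1} t * t powr (p - 1))"
    and integral_powr_01: "(LINT t|lborel. indicator {0<..<1} t * t powr (p - 1)) = 1 / p"
proof -
  have "Gamma (p + 1) = p * Gamma p" "Gamma p \<noteq> 0"
    using assms by (auto intro!: Gamma_plus1 simp: Gamma_eq_zero_iff elim!: nonpos_Ints_cases)
  then have Beta: "Beta p 1 = 1 / p" by (simp add: Beta_def)
  have ae: "AE t in lborel. ennreal (indicator {0..1} t * (t powr (p - 1) * (1 - t) powr (1 - 1))) = ennreal (indicator {0<..<1} t * t powr (p - 1))"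
  proof -
    have "AE t in lborel. t \<noteq> (0::real)" "AE t in lborel. t \<noteq> (1::real)" by (rule AE_lborel_singleton)+
    then show ?thesis by eventually_elim (auto split: split_indicator)
  qed
  have "(\<integral>\<^sup>+ t. ennreal (indicator {0<..<1} t * t powr (p - 1)) \<partial>lborel) = ennreal (1 / p)"
    using nn_integral_has_integral_lebesgue[OF _ has_integral_Beta_real[OF assms zero_less_one]]
    unfolding nn_integral_cong_AE[OF ae] by (simp add: Beta)
  then show "integrable lborel (\<lambda>t::real. indicator {0<..<1} t * t powr (p - 1))"
    "(LINT t|lborel. indicator {0<..<1} t * t powr (p - 1)) = 1 / p"
    using assms by (auto simp: integrable_iff_bounded integral_eq_nn_integral abs_mult)
qed

text \<open>The integral over \<open>t < 1\<close> with \<open>f x\<close> subtracted converges for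
  \<open>Re \<beta> > - \<epsilon>\<close> by the Hoelder estimate, the one over
  \<open>t \<ge> 1\<close> for \<open>Re \<beta> < a\<close>. The subtracted term is integrated
  explicitly.\<close>

lemma heat_flow_continuation:
  fixes f :: "real ^ 'n \<Rightarrow> complex"
  assumes f: "f \<in> decay_space a" and a: "0 < a" "a < real CARD('n)"
    and \<epsilon>: "0 < \<epsilon>" "\<epsilon> < 1"
    and M: "0 \<le> M" "\<And>y. norm (f y - f x) \<le> M * norm (x - y) powr \<epsilon>"
    and B: "\<And>y. norm (f y) \<le> B"
  obtains J where "J holomorphic_on {\<beta>. - \<epsilon> < Re \<beta> \<and> Re \<beta> < a}"
    "\<And>\<gamma>. 0 < \<gamma> \<Longrightarrow> \<gamma> < a \<Longrightarrow> J (of_real \<gamma>) = riesz_pot \<gamma> f x" "J 0 = f x"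
proof -
  note [measurable] = borel_measurable_decay_space[OF f]
  define u where "u = heat_flow f x"
  have [measurable]: "u \<in> borel_measurable borel" by (simp add: u_def)
  obtain C where C: "0 \<le> C" "\<And>t. 0 < t \<Longrightarrow> norm (u t - f x) \<le> C * t powr (\<epsilon> / 2)"
    unfolding u_def by (rule heat_flow_Hoelder[OF _ B \<epsilon> M]) auto
  have u: "integrable lborel (\<lambda>t. (indicator {0<..} t * t powr (s / 2 - 1)) *\<^sub>R u t)" if "0 < s" "s < a" for s
    using integrable_heat_flow[OF f that a(2), of x] that by (subst (asm) integrable_rl_iff) (auto simp: u_def)
  \<comment> \<open>\<open>w1\<close> and \<open>w2\<close> carry the part \<open>t < 1\<close> with \<open>f x\<close> subtracted and the part \<open>t \<ge> 1\<close>; the removed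
    term contributes \<open>2 / \<gamma>\<close>, which \<open>rGamma (\<gamma> / 2)\<close> turns into \<open>rGamma (\<gamma> / 2 + 1)\<close>\<close>
  define w1 where "w1 t = (indicator {0<..<1} t / t) *\<^sub>R (u t - f x)" for t
  define w2 where "w2 t = (indicator {1..} t / t) *\<^sub>R u t" for t
  have [measurable]: "w1 \<in> borel_measurable borel" "w2 \<in> borel_measurable borel"
    unfolding w1_def w2_def by measurable
  \<comment> \<open>Puts the weight into the form of \<open>holomorphic_on_integral_exp\<close> with
    \<open>l t = ln t / 2\<close>; the leftover \<open>1 / t\<close> is part of \<open>w1\<close>
    and \<open>w2\<close>.\<close>
  have ex: "exp (s * (ln t / 2)) / t = t powr (s / 2 - 1)" if "0 < t" for s t :: real
    using that by (simp add: powr_def exp_diff algebra_simps)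
  have w1: "of_real (exp (s * (ln t / 2))) * w1 t = (indicator {0<..<1} t * t powr (s / 2 - 1)) *\<^sub>R (u t - f x)" for s t
    using ex[of t s] by (auto simp: w1_def scaleR_conv_of_real split: split_indicator simp flip: of_real_mult of_real_divide)
  have w2: "of_real (exp (s * (ln t / 2))) * w2 t = (indicator {1..} t * t powr (s / 2 - 1)) *\<^sub>R u t" for s t
    using ex[of t s] by (auto simp: w2_def scaleR_conv_of_real split: split_indicator simp flip: of_real_mult of_real_divide)
  have i1: "integrable lborel (\<lambda>t. of_real (exp (s * (ln t / 2))) * w1 t)" if "- \<epsilon> < s" for s
    unfolding w1
  proof (rule Bochner_Integration.integrable_bound)
    show "integrable lborel (\<lambda>t. C * (indicator {0<..<1} t * t powr ((s + \<epsilon>) / 2 - 1)))"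
      using that by (intro integrable_mult_right integrable_powr_01) auto
    show "AE t in lborel. norm ((indicator {0<..<1} t * t powr (s / 2 - 1)) *\<^sub>R (u t - f x)) \<le> norm (C * (indicator {0<..<1} t * t powr ((s + \<epsilon>) / 2 - 1)))"
    proof (rule AE_I2)
      fix t :: real
      show "norm ((indicator {0<..<1} t * t powr (s / 2 - 1)) *\<^sub>R (u t - f x)) \<le> norm (C * (indicator {0<..<1} t * t powr ((s + \<epsilon>) / 2 - 1)))"
      proof (cases "t \<in> {0<..<1}")
        case True
        then have "t powr (s / 2 - 1) * norm (u t - f x) \<le> t powr (s / 2 - 1) * (C * t powr (\<epsilon> / 2))"
          using C by (intro mult_left_mono) auto
        also have "\<dots> = C * t powr ((s + \<epsilon>) / 2 - 1)"
        proof -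
          have "t powr (s / 2 - 1) * t powr (\<epsilon> / 2) = t powr ((s + \<epsilon>) / 2 - 1)"
            unfolding powr_add[symmetric] by (rule arg_cong[of _ _ "(powr) t"]) (simp add: add_divide_distrib)
          then show ?thesis by simp
        qed
        finally show ?thesis using True C by (simp add: abs_mult)
      qed simp
    qed
  qed measurable
  have i2: "integrable lborel (\<lambda>t. of_real (exp (s * (ln t / 2))) * w2 t)" if "s < a" for s
    unfolding w2
  proof (rule Bochner_Integration.integrable_bound)
    \<comment> \<open>Integrability of the flow is known for positive orders only. On
      \<open>t \<ge> 1\<close> a larger order dominates, so a positive \<open>r \<ge> s\<close>
      covers every \<open>s < a\<close>.\<close>
    define r where "r = max s (a / 2)"
    have r: "0 < r" "r < a" "s \<le> r" using that a by (auto simp: r_def)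
    show "integrable lborel (\<lambda>t. (indicator {0<..} t * t powr (r / 2 - 1)) *\<^sub>R u t)"
      by (rule u) fact+
    show "AE t in lborel. norm ((indicator {1..} t * t powr (s / 2 - 1)) *\<^sub>R u t) \<le> norm ((indicator {0<..} t * t powr (r / 2 - 1)) *\<^sub>R u t)"
      using r by (intro AE_I2) (auto simp: abs_mult split: split_indicator intro!: mult_right_mono powr_mono)
  qed measurable
  define A1 where "A1 \<beta> = (LINT t|lborel. exp (\<beta> * of_real (ln t / 2)) * w1 t)" for \<beta>
  define A2 where "A2 \<beta> = (LINT t|lborel. exp (\<beta> * of_real (ln t / 2)) * w2 t)" for \<beta>
  have A1: "A1 holomorphic_on {\<beta>. - \<epsilon> < Re \<beta> \<and> Re \<beta> < a}"
    unfolding A1_def by (intro holomorphic_on_integral_exp i1) auto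
  have A2: "A2 holomorphic_on {\<beta>. - \<epsilon> < Re \<beta> \<and> Re \<beta> < a}"
    unfolding A2_def by (intro holomorphic_on_integral_exp i2) auto
  \<comment> \<open>At \<open>\<beta> = 0\<close> the first summand vanishes because
    \<open>rGamma 0 = 0\<close>, and \<open>rGamma 1 = 1\<close> leaves \<open>f x\<close>.\<close>
  define J where "J \<beta> = rGamma (\<beta> / 2) * (A1 \<beta> + A2 \<beta>) + f x * rGamma (\<beta> / 2 + 1)" for \<beta>
  show thesis
  proof
    show "J holomorphic_on {\<beta>. - \<epsilon> < Re \<beta> \<and> Re \<beta> < a}"
      unfolding J_def by (intro holomorphic_intros A1 A2) auto
    show "J 0 = f x" by (simp add: J_def)
    fix \<gamma> :: real assume \<gamma>: "0 < \<gamma>" "\<gamma> < a"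
    have p: "0 < \<gamma> / 2" using \<gamma> by simp
    have A1': "A1 (of_real \<gamma>) = (LINT t|lborel. (indicator {0<..<1} t * t powr (\<gamma> / 2 - 1)) *\<^sub>R (u t - f x))"
      unfolding A1_def w1[symmetric] by (simp only: exp_of_real of_real_mult[symmetric])
    have A2': "A2 (of_real \<gamma>) = (LINT t|lborel. (indicator {1..} t * t powr (\<gamma> / 2 - 1)) *\<^sub>R u t)"
      unfolding A2_def w2[symmetric] by (simp only: exp_of_real of_real_mult[symmetric])
    have "riesz_pot \<gamma> f x = rGamma (of_real (\<gamma> / 2)) * (LINT t|lborel. (indicator {0<..} t * t powr (\<gamma> / 2 - 1)) *\<^sub>R u t)"
      using riesz_pot_eq_integral_heat_flow[OF f \<gamma> a(2)] p by (simp add: integral_rl u_def)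
    also have "(LINT t|lborel. (indicator {0<..} t * t powr (\<gamma> / 2 - 1)) *\<^sub>R u t) =
      (LINT t|lborel. (indicator {0<..<1} t * t powr (\<gamma> / 2 - 1)) *\<^sub>R (u t - f x) + (indicator {1..} t * t powr (\<gamma> / 2 - 1)) *\<^sub>R u t
         + (indicator {0<..<1} t * t powr (\<gamma> / 2 - 1)) *\<^sub>R f x)"
      by (intro Bochner_Integration.integral_cong) (auto simp: scaleR_diff_right split: split_indicator)
    also have "\<dots> = A1 (of_real \<gamma>) + A2 (of_real \<gamma>) + (1 / (\<gamma> / 2)) *\<^sub>R f x"
    proof -
      have j1: "integrable lborel (\<lambda>t. (indicator {0<..<1} t * t powr (\<gamma> / 2 - 1)) *\<^sub>R (u t - f x))"
        using i1[of \<gamma>] \<epsilon> \<gamma> unfolding w1 by simp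
      have j2: "integrable lborel (\<lambda>t. (indicator {1..} t * t powr (\<gamma> / 2 - 1)) *\<^sub>R u t)"
        using i2[of \<gamma>] \<gamma> unfolding w2 by simp
      have j3: "integrable lborel (\<lambda>t. (indicator {0<..<1} t * t powr (\<gamma> / 2 - 1)) *\<^sub>R f x)"
        by (rule integrable_scaleR_left) (rule integrable_powr_01[OF p])
      have "(LINT t|lborel. (indicator {0<..<1} t * t powr (\<gamma> / 2 - 1)) *\<^sub>R f x) = (1 / (\<gamma> / 2)) *\<^sub>R f x"
        using integral_powr_01[OF p] integrable_powr_01[OF p] by (subst integral_scaleR_left) auto
      then show ?thesis
        by (subst Bochner_Integration.integral_add[OF Bochner_Integration.integrable_add[OF j1 j2] j3],
            subst Bochner_Integration.integral_add[OF j1 j2]) (simp add: A1' A2')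
    qed
    also have "rGamma (of_real (\<gamma> / 2)) * \<dots> = J (of_real \<gamma>)"
    proof -
      have "rGamma (of_real (\<gamma> / 2) :: complex) = of_real (\<gamma> / 2) * rGamma (of_real (\<gamma> / 2) + 1)"
        by (rule rGamma_plus1[symmetric])
      then have "rGamma (of_real (\<gamma> / 2)) * ((1 / (\<gamma> / 2)) *\<^sub>R f x) = f x * rGamma (of_real (\<gamma> / 2) + 1)"
        using \<gamma> by (simp add: scaleR_conv_of_real field_simps)
      then show ?thesis by (simp add: J_def distrib_left)
    qed
    finally show "J (of_real \<gamma>) = riesz_pot \<gamma> f x" by simp
  qed
qed

text \<open>Outside a ball of radius \<open>r\<close> in the Hoelder neighbourhood the increment is
  at most \<open>2 * B\<close>, hence at most
  \<open>2 * B * (norm (x - y) / r) powr \<epsilon>\<close>; enlarging the constant makes the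
  estimate global.\<close>

lemma Hoelder_at_bounded:
  fixes f :: "real ^ 'n \<Rightarrow> complex"
  assumes "locally_Hoelder f" and B: "\<And>y. norm (f y) \<le> B"
  obtains \<epsilon> M where "0 < \<epsilon>" "\<epsilon> < 1" "0 \<le> M" "\<And>y. norm (f y - f x) \<le> M * norm (x - y) powr \<epsilon>"
proof -
  obtain U \<epsilon> M where U: "open U" "x \<in> U" and \<epsilon>: "0 < \<epsilon>" "\<epsilon> < 1" and M: "0 < M"
    and H: "\<And>y. y \<in> U \<Longrightarrow> norm (f y - f x) \<le> M * norm (y - x) powr \<epsilon>"
    using assms(1) unfolding locally_Hoelder_def by metis
  obtain r where r: "0 < r" "ball x r \<subseteq> U" using U by (auto simp: open_contains_ball)
  have B0: "0 \<le> B" using order_trans[OF norm_ge_zero B] .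
  show thesis
  proof
    show "0 < \<epsilon>" "\<epsilon> < 1" by fact+
    show "0 \<le> M + 2 * B * r powr (- \<epsilon>)" using M B0 by simp
    fix y
    show "norm (f y - f x) \<le> (M + 2 * B * r powr (- \<epsilon>)) * norm (x - y) powr \<epsilon>"
    proof (cases "norm (x - y) < r")
      case True
      then have "norm (f y - f x) \<le> M * norm (y - x) powr \<epsilon>"
        using r by (intro H) (auto simp: dist_norm)
      moreover have "0 \<le> 2 * B * r powr (- \<epsilon>) * norm (x - y) powr \<epsilon>" using B0 by simp
      ultimately show ?thesis by (simp add: distrib_right norm_minus_commute)
    next
      case False
      then have "1 \<le> (norm (x - y) / r) powr \<epsilon>"
        using r \<epsilon> by (intro ge_one_powr_ge_zero) auto
      then have "2 * B * 1 \<le> 2 * B * (norm (x - y) / r) powr \<epsilon>"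
        using B0 by (intro mult_left_mono) auto
      also have "\<dots> = 2 * B * r powr (- \<epsilon>) * norm (x - y) powr \<epsilon>"
        using r by (simp add: powr_divide powr_minus_divide)
      finally have "2 * B \<le> 2 * B * r powr (- \<epsilon>) * norm (x - y) powr \<epsilon>" by simp
      moreover have "norm (f y - f x) \<le> 2 * B"
        using norm_triangle_ineq4[of "f y" "f x"] B[of y] B[of x] by linarith
      moreover have "0 \<le> M * norm (x - y) powr \<epsilon>" using M by simp
      ultimately show ?thesis by (simp add: distrib_right)
    qed
  qed
qed

subsection \<open>Analytic continuation\<close>

text \<open>The kernel is exponential in \<beta> with \<open>l y = ln (norm (x - y))\<close>, which
  puts the integral under \<open>holomorphic_on_integral_exp\<close>; the constant is treated
  separately.\<close>

lemma riesz_integral_holomorphic: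
  fixes g :: "real ^ 'n \<Rightarrow> complex"
  assumes g: "g \<in> decay_space b" and b: "0 < b" "b < real CARD('n)"
  shows "(\<lambda>\<beta>. riesz_integral \<beta> g x) holomorphic_on {\<beta>. 0 < Re \<beta> \<and> Re \<beta> < b}"
proof -
  note [measurable] = borel_measurable_decay_space[OF g]
  let ?S = "{\<beta>. 0 < Re \<beta> \<and> Re \<beta> < b}"
  define l where "l y = ln (norm (x - y))" for y
  define w where "w y = of_real (norm (x - y) powr (- real CARD('n))) * g y" for y
  have [measurable]: "l \<in> borel_measurable borel" "w \<in> borel_measurable borel"
    unfolding l_def w_def by measurable
  \<comment> \<open>At \<open>y = x\<close> both sides are zero because
    \<open>0 powr z = 0\<close>.\<close>
  have e: "exp (\<beta> * of_real (l y)) * w y = g y * of_real (norm (x - y)) powr (\<beta> - of_nat CARD('n))" for \<beta> y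
  proof (cases "x = y")
    case False
    then have "of_real (norm (x - y)) powr (\<beta> - of_nat CARD('n)) = of_real (norm (x - y)) powr \<beta> * of_real (norm (x - y)) powr (- of_nat CARD('n) :: complex)"
      by (simp flip: powr_add)
    moreover have "of_real (norm (x - y)) powr \<beta> = exp (\<beta> * of_real (l y))"
      using False by (simp add: powr_def l_def Ln_of_real)
    moreover have "of_real (norm (x - y)) powr (- of_nat CARD('n) :: complex) = of_real (norm (x - y) powr (- real CARD('n)))"
      using powr_of_real[of "norm (x - y)" "- real CARD('n)"] by simp
    ultimately show ?thesis by (simp add: w_def)
  qed (simp add: w_def)
  have "(\<lambda>\<beta>. LINT y|lborel. exp (\<beta> * of_real (l y)) * w y) holomorphic_on ?S"
  proof (rule holomorphic_on_integral_exp)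
    fix s assume s: "0 < s" "s < b"
    have "of_real (exp (s * l y)) * w y = of_real (norm (x - y) powr (s - real CARD('n))) * g y" for y
    proof (cases "x = y")
      case False
      then have "exp (s * l y) = norm (x - y) powr s" by (simp add: l_def powr_def)
      then have "exp (s * l y) * norm (x - y) powr (- real CARD('n)) = norm (x - y) powr (s - real CARD('n))"
        by (simp flip: powr_add)
      then show ?thesis by (simp add: w_def flip: of_real_mult mult.assoc)
    qed (simp add: w_def)
    then show "integrable lborel (\<lambda>y. of_real (exp (s * l y)) * w y)"
      using integrable_decay_space[OF g s b(2), of x] by simp
  qed auto
  then have "(\<lambda>\<beta>. LINT y|lborel. g y * of_real (norm (x - y)) powr (\<beta> - of_nat CARD('n))) holomorphic_on ?S"
    by (simp add: e)
  moreover have "(\<lambda>\<beta>. 1 / riesz_const CARD('n) \<beta>) holomorphic_on ?S"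
  proof -
    \<comment> \<open>\<open>rGamma\<close> is entire, so poles can come only from the Gamma factor
      in the numerator, and \<open>Re \<beta> < b < CARD('n)\<close> avoids those.\<close>
    have "(\<lambda>\<beta>. Gamma ((of_nat CARD('n) - \<beta>) / 2) * rGamma (\<beta> / 2) / (2 powr \<beta> * of_real (pi powr (real CARD('n) / 2)))) holomorphic_on ?S"
    proof (intro holomorphic_intros)
      fix \<beta> assume "\<beta> \<in> ?S"
      then have "0 < Re ((of_nat CARD('n) - \<beta>) / 2)" using b by simp
      moreover have "Re z \<le> 0" if "z \<in> \<int>\<^sub>\<le>\<^sub>0" for z :: complex
        using that by (auto elim!: nonpos_Ints_cases)
      ultimately show "(of_nat CARD('n) - \<beta>) / 2 \<notin> \<int>\<^sub>\<le>\<^sub>0"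
        by (meson not_le)
    qed auto
    then show ?thesis
      by (rule holomorphic_transform)
         (simp only: riesz_const_def rGamma_inverse_Gamma divide_inverse inverse_mult_distrib inverse_inverse_eq mult_1_left mult_ac)
  qed
  ultimately show ?thesis
    unfolding riesz_integral_def by (intro holomorphic_on_mult)
qed

lemma Re_riesz_poles: "\<alpha> \<in> riesz_poles n \<Longrightarrow> real n \<le> Re \<alpha>"
  by (auto simp: riesz_poles_def)

lemma connected_strip: "connected {\<beta>. c < Re \<beta> \<and> Re \<beta> < b}"
proof -
  have "{\<beta>. c < Re \<beta> \<and> Re \<beta> < b} = {\<beta>. c < Re \<beta>} \<inter> {\<beta>. Re \<beta> < b}" by auto
  then show ?thesis
    by (simp only:) (intro convex_connected convex_Int convex_halfspace_Re_gt convex_halfspace_Re_lt)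
qed

lemma open_strip: "open {\<beta>. c < Re \<beta> \<and> Re \<beta> < b}"
  by (intro open_Collect_conj open_Collect_less continuous_intros)

text \<open>The identity theorem on the common strip. This makes the \<open>THE\<close> in
  \<open>riesz_potential\<close> well determined.\<close>

lemma riesz_continuation_value_unique:
  fixes g :: "real ^ 'n \<Rightarrow> complex"
  assumes "riesz_continuation_value \<alpha> g x v" "riesz_continuation_value \<alpha> g x v'" and \<alpha>: "Re \<alpha> \<le> 0"
  shows "v = v'"
proof -
  let ?P = "riesz_poles CARD('n)"
  obtain b c F where F: "0 < b" "c < 0" "c < Re \<alpha>" "F holomorphic_on ({\<beta>. c < Re \<beta> \<and> Re \<beta> < b} - ?P)"
    "\<And>\<beta>. 0 < Re \<beta> \<Longrightarrow> Re \<beta> < b \<Longrightarrow> \<beta> \<notin> ?P \<Longrightarrow> F \<beta> = riesz_integral \<beta> g x" "F \<alpha> = v"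
    using assms(1) unfolding riesz_continuation_value_def by blast
  obtain b' c' F' where F': "0 < b'" "c' < 0" "c' < Re \<alpha>" "F' holomorphic_on ({\<beta>. c' < Re \<beta> \<and> Re \<beta> < b'} - ?P)"
    "\<And>\<beta>. 0 < Re \<beta> \<Longrightarrow> Re \<beta> < b' \<Longrightarrow> \<beta> \<notin> ?P \<Longrightarrow> F' \<beta> = riesz_integral \<beta> g x" "F' \<alpha> = v'"
    using assms(2) unfolding riesz_continuation_value_def by blast
  \<comment> \<open>The cut at \<open>CARD('n)\<close> excludes all poles, so the common domain is a
    convex strip.\<close>
  define B where "B = min (min b b') (real CARD('n))"
  define C where "C = max c c'"
  have B: "0 < B" "B \<le> b" "B \<le> b'" "B \<le> real CARD('n)" and C: "C < Re \<alpha>" "c \<le> C" "c' \<le> C" "C < 0"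
    using F F' by (auto simp: B_def C_def)
  have np: "\<beta> \<notin> ?P" if "Re \<beta> < B" for \<beta>
    using Re_riesz_poles[of \<beta> "CARD('n)"] that B by auto
  have "F \<alpha> = F' \<alpha>"
  proof (rule analytic_continuation_open[of "{\<beta>. 0 < Re \<beta> \<and> Re \<beta> < B}" "{\<beta>. C < Re \<beta> \<and> Re \<beta> < B}" F F'])
    have "of_real (B / 2) \<in> {\<beta>. 0 < Re \<beta> \<and> Re \<beta> < B}" using B by simp
    then show "{\<beta>. 0 < Re \<beta> \<and> Re \<beta> < B} \<noteq> {}" by blast
    show "F holomorphic_on {\<beta>. C < Re \<beta> \<and> Re \<beta> < B}"
      using np B C by (intro holomorphic_on_subset[OF F(4)]) auto
    show "F' holomorphic_on {\<beta>. C < Re \<beta> \<and> Re \<beta> < B}"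
      using np B C by (intro holomorphic_on_subset[OF F'(4)]) auto
    show "F \<beta> = F' \<beta>" if "\<beta> \<in> {\<beta>. 0 < Re \<beta> \<and> Re \<beta> < B}" for \<beta>
      using F(5)[of \<beta>] F'(5)[of \<beta>] np[of \<beta>] that B by auto
  qed (use \<alpha> B C in \<open>auto intro: open_strip connected_strip\<close>)
  then show ?thesis using F(6) F'(6) by simp
qed

text \<open>The real segment accumulates inside the strip, so the identity theorem applies. It
  carries the composition law from real to complex orders.\<close>

lemma eq_on_strip_of_eq_on_reals:
  assumes "F holomorphic_on {\<beta>. a < Re \<beta> \<and> Re \<beta> < b}" "G holomorphic_on {\<beta>. a < Re \<beta> \<and> Re \<beta> < b}"
    and eq: "\<And>s :: real. a < s \<Longrightarrow> s < b \<Longrightarrow> F (of_real s) = G (of_real s)"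
    and \<beta>: "a < Re \<beta>" "Re \<beta> < b"
  shows "F \<beta> = G \<beta>"
proof -
  let ?m = "(a + b) / 2"
  have ab: "a < b" using \<beta> by simp
  have "F \<beta> - G \<beta> = 0"
  proof (rule analytic_continuation[where f = "\<lambda>\<beta>. F \<beta> - G \<beta>" and w = \<beta> and U = "of_real ` {a<..<b}" and \<xi> = "of_real ?m" and S = "{\<beta>. a < Re \<beta> \<and> Re \<beta> < b}"])
    show "(\<lambda>\<beta>. F \<beta> - G \<beta>) holomorphic_on {\<beta>. a < Re \<beta> \<and> Re \<beta> < b}"
      by (intro holomorphic_intros assms)
    show "(of_real ?m :: complex) islimpt of_real ` {a<..<b}"
    proof -
      have "?m islimpt {a<..<b}" using ab by (intro interior_limit_point) (simp add: interior_open)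
      then show ?thesis
        by (rule islimpt_isCont_image)
           (auto simp: eventually_at_filter simp del: of_real_add of_real_divide)
    qed
  qed (use ab \<beta> eq in \<open>auto intro: open_strip connected_strip\<close>)
  then show ?thesis by simp
qed

theorem proposition4p16:
  fixes f :: "real ^ 'n \<Rightarrow> complex" and k :: nat
  assumes "2 \<le> CARD('n)"
    and "k \<in> {1..CARD('n) - 1}"
    and "f \<in> C_space k"
  shows "\<forall>x. riesz_defined (of_nat k) f x \<and>
             riesz_defined (- of_nat k) (riesz_potential (of_nat k) f) x \<and>
             riesz_potential (- of_nat k) (riesz_potential (of_nat k) f) x = f x"
proof
  fix x
  have k: "0 < real k" "real k < real CARD('n)" using assms(1,2) by auto
  obtain \<delta> where \<delta>: "0 < \<delta>" "f \<in> decay_space (real k + \<delta>)" and H: "locally_Hoelder f"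
    using assms(3) by (auto simp: C_space_def)
  \<comment> \<open>lowering the decay exponent below \<open>CARD('n)\<close> keeps all strips clear of the poles\<close>
  define a where "a = min (real k + \<delta>) ((real k + real CARD('n)) / 2)"
  have a: "real k < a" "a < real CARD('n)" "0 < a" using \<delta> k by (auto simp: a_def min_less_iff_disj)
  have f: "f \<in> decay_space a" by (rule decay_space_mono[OF \<delta>(2)]) (simp add: a_def)
  obtain B where B: "\<And>y. norm (f y) \<le> B"
  proof -
    \<comment> \<open>At exponent zero the weight in \<open>decay_space_bound\<close> is constant,
      which gives a global bound.\<close>
    have "f \<in> decay_space 0" using f a by (auto intro: decay_space_mono)
    then obtain D where D: "\<And>y. norm (f y) \<le> D * (1 + norm y) powr (- 0)"
      by (rule decay_space_bound[OF _ order_refl]) blast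
    have "norm (f y) \<le> D" for y
    proof -
      have "1 + norm y \<noteq> 0" by (simp add: add_nonneg_eq_0_iff)
      then show ?thesis using D[of y] by simp
    qed
    then show thesis by (rule that)
  qed
  obtain \<epsilon> M where \<epsilon>: "0 < \<epsilon>" "\<epsilon> < 1" and M: "0 \<le> M" "\<And>y. norm (f y - f x) \<le> M * norm (x - y) powr \<epsilon>"
    by (rule Hoelder_at_bounded[OF H B, of x]) blast
  obtain J where J: "J holomorphic_on {\<beta>. - \<epsilon> < Re \<beta> \<and> Re \<beta> < a}"
    "\<And>\<gamma>. 0 < \<gamma> \<Longrightarrow> \<gamma> < a \<Longrightarrow> J (of_real \<gamma>) = riesz_pot \<gamma> f x" "J 0 = f x"
    by (rule heat_flow_continuation[OF f a(3,2) \<epsilon> M B]) blast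
  define g where "g = riesz_potential (of_nat k) f"
  have g: "g = riesz_pot (real k) f"
    using k riesz_integral_of_real[of "real k" f] by (simp add: g_def fun_eq_iff riesz_potential_def)
  \<comment> \<open>The decay exponent of \<open>g\<close>; \<open>Re \<beta> < b\<close> is the
    same as \<open>Re (\<beta> + k) < a\<close>, the right edge of the domain of
    \<open>J\<close>.\<close>
  define b where "b = a - real k"
  have b: "0 < b" "b < real CARD('n)" using a k by (auto simp: b_def)
  have gd: "g \<in> decay_space b"
    unfolding g b_def by (rule riesz_pot_decay_space[OF f]) (use k a in auto)
  have np: "\<beta> \<notin> riesz_poles CARD('n)" if "Re \<beta> < real CARD('n)" for \<beta>
    using Re_riesz_poles[of \<beta> "CARD('n)"] that by auto
  \<comment> \<open>The shift by \<open>k\<close> carries the strip of \<open>J\<close> to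
    \<open>- k - \<epsilon> < Re \<beta> < b\<close> and sends \<open>- k\<close> to 0, where
    \<open>J\<close> has the value \<open>f x\<close>.\<close>
  let ?F = "\<lambda>\<beta>. J (\<beta> + of_nat k)"
  have "riesz_continuation_value (- of_nat k) g x (f x)"
    unfolding riesz_continuation_value_def
  proof (rule exI[of _ b], rule exI[of _ "- real k - \<epsilon>"], rule exI[of _ ?F], intro conjI allI impI)
    have "?F holomorphic_on {\<beta>. - real k - \<epsilon> < Re \<beta> \<and> Re \<beta> < b}"
      by (rule holomorphic_on_compose_gen[OF _ J(1), unfolded comp_def])
         (auto intro!: holomorphic_intros simp: b_def)
    then show "?F holomorphic_on {\<beta>. - real k - \<epsilon> < Re \<beta> \<and> Re \<beta> < b} - riesz_poles CARD('n)"
      by (rule holomorphic_on_subset) auto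
    fix \<beta> assume \<beta>: "0 < Re \<beta> \<and> Re \<beta> < b \<and> \<beta> \<notin> riesz_poles CARD('n)"
    show "?F \<beta> = riesz_integral \<beta> g x"
    \<comment> \<open>On the real segment the claim is \<open>riesz_pot_riesz_pot\<close>: the
      potential of order \<open>s\<close> of \<open>g\<close> is that of order \<open>s + k\<close>
      of \<open>f\<close>.\<close>
    proof (rule eq_on_strip_of_eq_on_reals[where F = ?F and G = "\<lambda>\<beta>. riesz_integral \<beta> g x" and a = 0 and b = b])
      show "?F holomorphic_on {\<beta>. 0 < Re \<beta> \<and> Re \<beta> < b}"
        by (rule holomorphic_on_subset[OF \<open>?F holomorphic_on {\<beta>. - real k - \<epsilon> < Re \<beta> \<and> Re \<beta> < b}\<close>])
           (use \<epsilon> in auto)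
      show "(\<lambda>\<beta>. riesz_integral \<beta> g x) holomorphic_on {\<beta>. 0 < Re \<beta> \<and> Re \<beta> < b}"
        by (rule riesz_integral_holomorphic[OF gd b])
      fix s :: real assume s: "0 < s" "s < b"
      have "?F (of_real s) = riesz_pot (s + real k) f x"
        using J(2)[of "s + real k"] s by (simp add: b_def)
      also have "\<dots> = riesz_integral (of_real s) g x"
        unfolding riesz_integral_of_real g
        by (rule riesz_pot_riesz_pot[OF f, symmetric]) (use s k a in \<open>auto simp: b_def\<close>)
      finally show "?F (of_real s) = riesz_integral (of_real s) g x" .
    qed (use \<beta> in auto)
  qed (use b gd \<epsilon> J(3) k in auto)
  then have "riesz_defined (- of_nat k) g x" "riesz_potential (- of_nat k) g x = f x"
    using riesz_continuation_value_unique[of "- of_nat k" g x]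
    by (auto simp: riesz_defined_def riesz_potential_def intro!: the_equality)
  moreover have "riesz_defined (of_nat k) f x"
    using k a f np[of "of_nat k"] by (auto simp: riesz_defined_def)
  ultimately show "riesz_defined (of_nat k) f x \<and>
             riesz_defined (- of_nat k) (riesz_potential (of_nat k) f) x \<and>
             riesz_potential (- of_nat k) (riesz_potential (of_nat k) f) x = f x"
    by (simp add: g_def)
qed

end
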